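(* Suppose that (A1) for all $b,b'\in\mathcal B$, $\phi(b,t)-\phi(b',t)$ is single-crossing in $t$ and $v(b,t)-v(b',t)$ is monotonic in $t$; and (A2) for all $a,a'\in\Delta(\mathcal B)$, $\phi(a,t)-\phi(a',t)$ is single-crossing in $t$. Suppose there exists $b^{root}\in\mathcal B$ such that: 1. $\{b^{root}\}=\operatorname{argmax}_{\tilde b\in\mathcal B}Q(\tilde b)$; and 2. for every $b\in\mathcal B$ that does not contain $b^{root}$ (i.e. $b\not\supseteq b^{root}$), $v(b,\bar t)<v(b^{root},\bar t)$. Then the minimal optimal menu of the monopolist's problem is either a tree menu or a nested menu.
   Context: Setup. There are $n\ge 1$ goods; $\mathcal B=2^{\{1,\dots,n\}}$ is the set of (deterministic) bundles and $\Delta(\mathcal B)$ is the set of probability distributions on $\mathcal B$ (stochastic bundles); a bundle $b$ is identified with the point mass at $b$. Types $t$ lie in $T=[\underline t,\bar t]\subseteq\mathbb R$, $\underline t<\bar t$, and are distributed according to $F$ with a continuous, positive density $f$. The value function $v:\Delta(\mathcal B)\times T\to\mathbb R$ is continuously differentiable in $t$, with $v(\emptyset,t)=0$ for all $t$ and $v(a,t)=\mathbb E_{b\sim a}[v(b,t)]$. The virtual value function is $\phi(b,t)=v(b,t)-\frac{1-F(t)}{f(t)}v_t(b,t)$, $v_t=\partial v/\partial t$, extended by $\phi(a,t)=\mathbb E_{b\sim a}[\phi(b,t)]$ for $a\in\Delta(\mathcal B)$; note $\phi(b,\bar t)=v(b,\bar t)$. Standing assumptions: for $b\ne b'$ in $\mathcal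 B$ there is $t\in T$ with $\phi(b,t)\neq\phi(b',t)$; $\max_{b\neq\emptyset}\phi(b,\underline t)<0=\phi(\emptyset,\underline t)$; and $v(b,\bar t)>0$ for all $b\ne\emptyset$. Sold-alone quantity. For $b\ne\emptyset$, $Q(b)=1-F(t_b)\in[0,1]$ where $t_b\in T$ satisfies $\phi(b,t_b)=0$; it is assumed that this zero $t_b$ is unique for each $b\neq\emptyset$, so that $Q$ is well defined. Convention: $Q(\emptyset)=0$. Terminology. A function $g:T\to\mathbb R$ is single-crossing in $t$ if $\operatorname{sign}[g(t)]\in\{-1,0,1\}$ is a monotonic function of $t$ (either weakly increasing or weakly decreasing). "Monotonic" means weakly increasing or weakly decreasing on $T$. Monopolist's problem. A mechanism is a measurable map $(a,p):T\to\Delta(\mathcal B)\times\mathbb R$. It is IC if $v(a(t),t)-p(t)\ge v(a(t'),t)-p(t')$ for all $t,t'\in T$, and IR if $v(a(t),t)-p(t)\ge 0$ for all $t\in T$. The monopolist maximizes $\mathbb E[p(t)]$ over IC and IR mechanisms. A menu $B\subseteq\mathcal B$ is optimal if there is an optimal mechanism $(a,p)$ with $a(t)\in B$ for all $t$; an optimal menu $B$ is a minimal optimal menu if no $B'\subsetneq B$ is optimal. (Under (A1) and (A2) the minimal optimal menu is unique.) A menu is nested if any two of its bundles are ordered by set inclusion. A menu $\{b_1,\dots,b_m\}$ is a tree menu if (1) there is $i$ with $b_i\ne\emptyset$ and $b_i\subseteq b_j$ for every $b_j\neq\emptyset$ in the menu, and (2) there are $k,l$ with $b_k\not\subseteq b_l$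 and $b_l\not\subseteq b_k$. *)

theory Defs
  imports "HOL-Probability.Probability"
begin

definition monotonic_on :: "real set \<Rightarrow> (real \<Rightarrow> real) \<Rightarrow> bool" where
  "monotonic_on T g \<longleftrightarrow> mono_on T g \<or> antimono_on T g"

definition single_crossing_on :: "real set \<Rightarrow> (real \<Rightarrow> real) \<Rightarrow> bool" where
  "single_crossing_on T g \<longleftrightarrow> monotonic_on T (\<lambda>t. sgn (g t))"

definition nested_menu :: "'g set set \<Rightarrow> bool" where
  "nested_menu B \<longleftrightarrow> (\<forall>b\<in>B. \<forall>b'\<in>B. b \<subseteq> b' \<or> b' \<subseteq> b)"

definition tree_menu :: "'g set set \<Rightarrow> bool" where
  "tree_menu B \<longleftrightarrow>
     (\<exists>b\<in>B. b \<noteq> {} \<and> (\<forall>b'\<in>B. b' \<noteq> {} \<longrightarrow> b \<subseteq> b')) \<and>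
     (\<exists>b\<in>B. \<exists>b'\<in>B. \<not> b \<subseteq> b' \<and> \<not> b' \<subseteq> b)"

text \<open>
  The goods are the elements of a finite type, so that bundles are its subsets, menus are sets
  of bundles, and stochastic bundles are probability mass functions on bundles. The types are
  the elements of the interval from \<open>lo\<close> to \<open>hi\<close>; the values of \<open>f\<close>, \<open>v b\<close> and of mechanisms
  outside this interval are irrelevant. The function \<open>v\<close> is given on deterministic bundles; its
  extension to stochastic bundles, linear in probabilities, is \<open>value_sto\<close>.
\<close>

locale bundling =
  fixes lo hi :: real
    and f :: "real \<Rightarrow> real"
    and v :: "'g::finite set \<Rightarrow> real \<Rightarrow> real"
begin

definition types :: "real set" where
  "types = {lo..hi}"

definition type_dist :: "real measure" where
  "type_dist = density lborel (\<lambda>t. ennreal (indicator types t * f t))"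

definition F :: "real \<Rightarrow> real" where
  "F = cdf type_dist"

text \<open>The derivative is one-sided at the two end points.\<close>

definition v_t :: "'g set \<Rightarrow> real \<Rightarrow> real" where
  "v_t b t = vector_derivative (v b) (at t within types)"

definition \<phi> :: "'g set \<Rightarrow> real \<Rightarrow> real" where
  "\<phi> b t = v b t - (1 - F t) / f t * v_t b t"

definition value_sto :: "'g set pmf \<Rightarrow> real \<Rightarrow> real" where
  "value_sto a t = measure_pmf.expectation a (\<lambda>b. v b t)"

definition \<phi>_sto :: "'g set pmf \<Rightarrow> real \<Rightarrow> real" where
  "\<phi>_sto a t = measure_pmf.expectation a (\<lambda>b. \<phi> b t)"

definition Q :: "'g set \<Rightarrow> real" where
  "Q b = (if b = {} then 0 else 1 - F (THE t. t \<in> types \<and> \<phi> b t = 0))"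

text \<open>
  Since there are finitely many bundles, measurability of an allocation rule with respect to the
  Borel sets of the simplex of stochastic bundles is measurability of each probability.
\<close>

definition mechanism :: "(real \<Rightarrow> 'g set pmf) \<Rightarrow> (real \<Rightarrow> real) \<Rightarrow> bool" where
  "mechanism a p \<longleftrightarrow>
     (\<forall>b. (\<lambda>t. pmf (a t) b) \<in> borel_measurable (restrict_space borel types)) \<and>
     p \<in> borel_measurable (restrict_space borel types)"

definition IC :: "(real \<Rightarrow> 'g set pmf) \<Rightarrow> (real \<Rightarrow> real) \<Rightarrow> bool" where
  "IC a p \<longleftrightarrow>
     (\<forall>t\<in>types. \<forall>t'\<in>types. value_sto (a t) t - p t \<ge> value_sto (a t') t - p t')"

definition IR :: "(real \<Rightarrow> 'g set pmf) \<Rightarrow> (real \<Rightarrow> real) \<Rightarrow> bool" where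
  "IR a p \<longleftrightarrow> (\<forall>t\<in>types. value_sto (a t) t - p t \<ge> 0)"

definition feasible :: "(real \<Rightarrow> 'g set pmf) \<Rightarrow> (real \<Rightarrow> real) \<Rightarrow> bool" where
  "feasible a p \<longleftrightarrow> mechanism a p \<and> IC a p \<and> IR a p"

text \<open>
  The transfer rule of a feasible mechanism is bounded on \<open>types\<close>, hence integrable.
\<close>

definition revenue :: "(real \<Rightarrow> real) \<Rightarrow> real" where
  "revenue p = (LINT t:types|type_dist. p t)"

definition optimal_mechanism :: "(real \<Rightarrow> 'g set pmf) \<Rightarrow> (real \<Rightarrow> real) \<Rightarrow> bool" where
  "optimal_mechanism a p \<longleftrightarrow>
     feasible a p \<and> (\<forall>a' p'. feasible a' p' \<longrightarrow> revenue p' \<le> revenue p)"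

definition optimal_menu :: "'g set set \<Rightarrow> bool" where
  "optimal_menu B \<longleftrightarrow>
     (\<exists>a p. optimal_mechanism a p \<and> (\<forall>t\<in>types. a t \<in> return_pmf ` B))"

definition minimal_optimal_menu :: "'g set set \<Rightarrow> bool" where
  "minimal_optimal_menu B \<longleftrightarrow> optimal_menu B \<and> (\<forall>B'. B' \<subset> B \<longrightarrow> \<not> optimal_menu B')"

end

locale bundling_setup = bundling lo hi f v
  for lo hi :: real
    and f :: "real \<Rightarrow> real"
    and v :: "'g::finite set \<Rightarrow> real \<Rightarrow> real" +
  assumes lo_less_hi: "lo < hi"
    and density_continuous: "continuous_on types f"
    and density_pos: "\<And>t. t \<in> types \<Longrightarrow> f t > 0"
    and prob_space_type_dist: "prob_space type_dist"
    and value_differentiable: "\<And>b. v b differentiable_on types"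
    and value_deriv_continuous: "\<And>b. continuous_on types (v_t b)"
    and value_empty: "\<And>t. t \<in> types \<Longrightarrow> v {} t = 0"
    and virtual_distinct: "\<And>b b'. b \<noteq> b' \<Longrightarrow> \<exists>t\<in>types. \<phi> b t \<noteq> \<phi> b' t"
    and virtual_lo_neg: "\<And>b. b \<noteq> {} \<Longrightarrow> \<phi> b lo < 0"
    and value_hi_pos: "\<And>b. b \<noteq> {} \<Longrightarrow> v b hi > 0"
    and virtual_zero_unique: "\<And>b. b \<noteq> {} \<Longrightarrow> \<exists>!t. t \<in> types \<and> \<phi> b t = 0"

end

theory Submission imports Defs begin

text \<open>
  Call a bundle a strict maximizer if its virtual value strictly exceeds all others at some type.
  The strict maximizers form the unique minimal optimal menu. By the envelope theorem, revenue is
  the expected virtual value of the allocation minus the rent of the lowest type, so a menu that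
  lacks a strict maximizer loses revenue near the type where it is the maximizer. Conversely, (A2)
  makes every linear combination of virtual values single-crossing, so that these functions span a
  space that behaves like a two-dimensional one and at every type some maximizer is a strict
  maximizer of some type. Differences of values of strict maximizers are monotonic in the same
  direction as the sign of their virtual counterparts, hence selecting the maximizer with the
  largest value at \<open>hi\<close> is implementable.

  The root has the first zero of all virtual values, so any other nonempty strict maximizer
  overtakes it later on; it is then worth more than the root at \<open>hi\<close> and so contains the root.
\<close>

subsection \<open>An envelope theorem\<close>

lemma bounded_borel_set_integrable:
  fixes h :: "real \<Rightarrow> real"
  assumes h: "h \<in> borel_measurable (restrict_space borel {a..b})"
    and B: "\<And>t. t \<in> {a..b} \<Longrightarrow> \<bar>h t\<bar> \<le> B"
  shows "set_integrable lborel {a..b} h"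
  unfolding set_integrable_def
proof (rule Bochner_Integration.integrable_bound)
  show "integrable lborel (\<lambda>t. indicator {a..b} t *\<^sub>R B)"
    using borel_integrable_atLeastAtMost'[of a b "\<lambda>_. B"] by (simp add: set_integrable_def)
  show "(\<lambda>t. indicator {a..b} t *\<^sub>R h t) \<in> borel_measurable lborel"
    using h by (subst (asm) borel_measurable_restrict_space_iff) auto
  show "AE t in lborel. norm (indicator {a..b} t *\<^sub>R h t) \<le> norm (indicator {a..b} t *\<^sub>R B)"
    using B by (intro AE_I2) (fastforce simp: indicator_def)
qed

lemma has_real_derivative_imp_Lipschitz:
  fixes g g' :: "real \<Rightarrow> real"
  assumes g: "\<And>t. t \<in> {a..b} \<Longrightarrow> (g has_real_derivative g' t) (at t within {a..b})"
    and g': "continuous_on {a..b} g'"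
  shows "\<exists>L\<ge>0. \<forall>s\<in>{a..b}. \<forall>t\<in>{a..b}. \<bar>g t - g s\<bar> \<le> L * \<bar>t - s\<bar>"
proof -
  have "bounded (g' ` {a..b})"
    using g' compact_continuous_image compact_imp_bounded by blast
  then obtain L where L: "L > 0" "\<And>t. t \<in> {a..b} \<Longrightarrow> \<bar>g' t\<bar> \<le> L"
    unfolding bounded_pos by auto
  have "\<bar>g t - g s\<bar> \<le> L * \<bar>t - s\<bar>" if "s \<in> {a..b}" "t \<in> {a..b}" for s t
    using field_differentiable_bound[of "{a..b}" g g' L t s] g L that by auto
  with L show ?thesis
    by (intro exI[of _ L]) auto
qed

text \<open>Difference quotients of a monotone function are nonnegative, and so is their limit.
  Derivatives within the interval cover the end points too.\<close>

lemma mono_on_deriv_nonneg_within: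
  fixes g :: "real \<Rightarrow> real"
  assumes "mono_on {a..b} g" and "(g has_real_derivative d) (at t within {a..b})"
    and t: "t \<in> {a..b}" and "a < b"
  shows "d \<ge> 0"
proof (rule tendsto_lowerbound)
  show "((\<lambda>s. (g s - g t) / (s - t)) \<longlongrightarrow> d) (at t within {a..b})"
    using assms(2) by (simp add: has_field_derivative_iff)
  have "(g s - g t) / (s - t) \<ge> 0" if "s \<in> {a..b}" "s \<noteq> t" for s
    using mono_onD[OF assms(1) that(1) t] mono_onD[OF assms(1) t that(1)] that(2)
    by (cases "s \<le> t") (auto simp: divide_nonpos_neg)
  then show "\<forall>\<^sub>F s in at t within {a..b}. 0 \<le> (g s - g t) / (s - t)"
    by (auto simp: eventually_at_filter)
  show "at t within {a..b} \<noteq> bot"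
    using t \<open>a < b\<close> by (auto simp: trivial_limit_within intro!: islimpt_closure_open[where s="{a<..<b}"])
qed

text \<open>Bounded Borel weights on continuous functions are the form of every allocation-dependent
  integrand below. The explicit bound also serves for dominated convergence.\<close>

lemma bounded_borel_sum_integrable:
  fixes q g :: "'i \<Rightarrow> real \<Rightarrow> real"
  assumes q: "\<And>i. i \<in> I \<Longrightarrow> q i \<in> borel_measurable (restrict_space borel {a..b})"
    and bq: "\<And>i t. i \<in> I \<Longrightarrow> t \<in> {a..b} \<Longrightarrow> \<bar>q i t\<bar> \<le> B"
    and g: "\<And>i. i \<in> I \<Longrightarrow> continuous_on {a..b} (g i)"
    and bg: "\<And>i t. i \<in> I \<Longrightarrow> t \<in> {a..b} \<Longrightarrow> \<bar>g i t\<bar> \<le> C i"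
    and B0: "B \<ge> 0"
  shows "(\<lambda>t. \<Sum>i\<in>I. q i t * g i t) integrable_on {a..b}"
    and "\<And>t. t \<in> {a..b} \<Longrightarrow> norm (\<Sum>i\<in>I. q i t * g i t) \<le> (\<Sum>i\<in>I. B * C i)"
proof -
  show bd: "norm (\<Sum>i\<in>I. q i t * g i t) \<le> (\<Sum>i\<in>I. B * C i)" if "t \<in> {a..b}" for t
    by (rule sum_norm_le) (auto simp: abs_mult intro!: mult_mono bq[OF _ that] bg[OF _ that] B0)
  show "(\<lambda>t. \<Sum>i\<in>I. q i t * g i t) integrable_on {a..b}"
  proof (rule set_borel_integral_eq_integral(1), rule bounded_borel_set_integrable)
    show "(\<lambda>t. \<Sum>i\<in>I. q i t * g i t) \<in> borel_measurable (restrict_space borel {a..b})"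
      by (intro borel_measurable_sum borel_measurable_times q borel_measurable_continuous_on_restrict g)
  qed (use bd in auto)
qed

text \<open>
  An envelope theorem that needs no differentiability of \<open>W\<close>: averaging the supporting inequality
  at \<open>t\<close> and \<open>t + h\<close> over \<open>t\<close> and letting \<open>h\<close> tend to zero from either side
  bounds the increments of \<open>W\<close> from both sides.
\<close>

lemma envelope_has_integral:
  fixes \<psi> \<psi>' q :: "'i \<Rightarrow> real \<Rightarrow> real"
  assumes "finite I" and "lo < hi"
    and deriv: "\<And>i t. i \<in> I \<Longrightarrow> t \<in> {lo..hi} \<Longrightarrow>
      (\<psi> i has_real_derivative \<psi>' i t) (at t within {lo..hi})"
    and cont: "\<And>i. i \<in> I \<Longrightarrow> continuous_on {lo..hi} (\<psi>' i)"
    and meas: "\<And>i. i \<in> I \<Longrightarrow> q i \<in> borel_measurable (restrict_space borel {lo..hi})"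
    and bdd: "\<And>i t. i \<in> I \<Longrightarrow> t \<in> {lo..hi} \<Longrightarrow> \<bar>q i t\<bar> \<le> B"
    and W: "\<And>t. t \<in> {lo..hi} \<Longrightarrow> W t = (\<Sum>i\<in>I. q i t * \<psi> i t)"
    and support: "\<And>s t. s \<in> {lo..hi} \<Longrightarrow> t \<in> {lo..hi} \<Longrightarrow> (\<Sum>i\<in>I. q i s * \<psi> i t) \<le> W t"
  shows "((\<lambda>t. \<Sum>i\<in>I. q i t * \<psi>' i t) has_integral (W hi - W lo)) {lo..hi}"
\<comment> \<open>\<open>B \<ge> 0\<close> is read off an index, so the empty index set is treated
  apart.\<close>
proof (cases "I = {}")
  case True
  then show ?thesis using W[of lo] W[of hi] \<open>lo < hi\<close> by simp
next
  case False
  let ?u = "\<lambda>t. \<Sum>i\<in>I. q i t * \<psi>' i t"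
  have B0: "B \<ge> 0"
    using False bdd[of _ lo] \<open>lo < hi\<close> abs_ge_zero order_trans by (metis all_not_in_conv atLeastAtMost_iff less_imp_le order_refl)
  have "\<forall>i\<in>I. \<exists>L\<ge>0. \<forall>s\<in>{lo..hi}. \<forall>t\<in>{lo..hi}. \<bar>\<psi> i t - \<psi> i s\<bar> \<le> L * \<bar>t - s\<bar>"
    using has_real_derivative_imp_Lipschitz[OF deriv cont] by blast
  then obtain L where L0: "\<And>i. i \<in> I \<Longrightarrow> L i \<ge> 0"
    and L: "\<And>i s t. i \<in> I \<Longrightarrow> s \<in> {lo..hi} \<Longrightarrow> t \<in> {lo..hi} \<Longrightarrow> \<bar>\<psi> i t - \<psi> i s\<bar> \<le> L i * \<bar>t - s\<bar>"
    by metis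
  have "\<forall>i\<in>I. \<exists>C. \<forall>t\<in>{lo..hi}. \<bar>\<psi>' i t\<bar> \<le> C"
    using cont compact_continuous_image compact_imp_bounded
    by (metis (no_types, opaque_lifting) bounded_iff compact_Icc imageI real_norm_def)
  then obtain C where C: "\<And>i t. i \<in> I \<Longrightarrow> t \<in> {lo..hi} \<Longrightarrow> \<bar>\<psi>' i t\<bar> \<le> C i"
    by metis
  have \<psi>_cont: "continuous_on {lo..hi} (\<psi> i)" if "i \<in> I" for i
    using deriv[OF that] by (meson DERIV_continuous_on)
  \<comment> \<open>\<open>K\<close> is a Lipschitz constant of \<open>W\<close>, because the
    weights of \<open>s\<close> remain available at \<open>t\<close>; it also dominates the
    difference quotients \<open>G\<close> below.\<close>
  define K where "K = (\<Sum>i\<in>I. B * L i)"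
  have step: "W s - W t \<le> K * \<bar>t - s\<bar>" if st: "s \<in> {lo..hi}" "t \<in> {lo..hi}" for s t
  proof -
    have "W s - W t \<le> (\<Sum>i\<in>I. q i s * \<psi> i s) - (\<Sum>i\<in>I. q i s * \<psi> i t)"
      using support[OF st] W[OF st(1)] by linarith
    also have "\<dots> = (\<Sum>i\<in>I. q i s * (\<psi> i s - \<psi> i t))"
      by (simp add: sum_subtractf right_diff_distrib)
    also have "\<dots> \<le> (\<Sum>i\<in>I. B * (L i * \<bar>t - s\<bar>))"
    proof (rule sum_mono)
      fix i assume i: "i \<in> I"
      have "q i s * (\<psi> i s - \<psi> i t) \<le> \<bar>q i s\<bar> * \<bar>\<psi> i s - \<psi> i t\<bar>"
        by (metis abs_ge_self abs_mult)
      also have "\<dots> \<le> B * (L i * \<bar>t - s\<bar>)"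
        using L[OF i st(2,1)] bdd[OF i st(1)] B0 by (intro mult_mono) (auto simp: abs_minus_commute)
      finally show "q i s * (\<psi> i s - \<psi> i t) \<le> B * (L i * \<bar>t - s\<bar>)" .
    qed
    finally show ?thesis by (simp add: K_def sum_distrib_right mult.assoc)
  qed
  have "K-lipschitz_on {lo..hi} W"
    using step L0 B0 unfolding lipschitz_on_def dist_real_def K_def
    by (auto intro!: sum_nonneg simp: abs_le_iff) (metis abs_minus_commute atLeastAtMost_iff)
  then have W_cont: "continuous_on {lo..hi} W"
    by (rule lipschitz_on_continuous_on)
  have u_int: "?u integrable_on {lo..hi}"
    by (rule bounded_borel_sum_integrable[where B=B and C=C]) (use meas bdd cont C B0 in auto)
  \<comment> \<open>An antiderivative of \<open>W\<close>: integrals of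
    \<open>W (t + h) - W t\<close>, divided by \<open>h\<close>, become difference quotients of
    \<open>P\<close> at the two ends.\<close>
  define P where "P = (\<lambda>t. integral {lo..t} W)"
  have P_deriv: "(P has_real_derivative W t) (at t)" if "t \<in> {lo<..<hi}" for t
    using integral_has_real_derivative[OF W_cont, of t] that
    unfolding P_def by (auto simp: at_within_Icc_at)
  \<comment> \<open>\<sigma> is the sign of the shift: 1 bounds the integral from above, -1 from
    below.\<close>
  have key: "\<sigma> * integral {x..y} ?u \<le> \<sigma> * (W y - W x)"
    if xy: "lo < x" "x < y" "y < hi" and \<sigma>: "\<sigma> = 1 \<or> \<sigma> = -1" for x y \<sigma>
  proof -
    \<comment> \<open>The margin that keeps shifted points inside \<open>{lo..hi}\<close>; it is
      positive because \<open>x\<close> and \<open>y\<close> are interior.\<close>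
    define \<delta> where "\<delta> = min (x - lo) (hi - y)"
    have \<delta>: "\<delta> > 0" using xy by (simp add: \<delta>_def)
    define h where "h n = \<sigma> * (\<delta> / real (Suc n))" for n
    have h_abs: "\<bar>h n\<bar> = \<delta> / real (Suc n)" for n
      using \<sigma> \<delta> by (auto simp: h_def)
    have h_bd: "\<bar>h n\<bar> \<le> \<delta>" for n
      using \<delta> unfolding h_abs by (simp add: divide_le_eq mult_le_cancel_left1)
    have h_nz: "h n \<noteq> 0" for n
      using \<sigma> \<delta> by (auto simp: h_def)
    have h_inv: "\<sigma> / h n = 1 / \<bar>h n\<bar>" for n
      using \<sigma> \<delta> unfolding h_abs by (auto simp: h_def)
    have "h \<longlonglongrightarrow> 0"
      using tendsto_mult_right_zero[OF LIMSEQ_Suc[OF lim_const_over_n[of \<delta>]], of \<sigma>]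
      by (simp add: h_def[abs_def])
    then have h_lim: "filterlim h (at 0) sequentially"
      using h_nz by (auto simp: filterlim_at)
    have h_mem: "t + h n \<in> {lo..hi}" if "t \<in> {x..y}" for t n
      using h_bd[of n] that xy by (auto simp: \<delta>_def)
    \<comment> \<open>The weights stay frozen at \<open>t\<close> while only the functions move, so
      the limit needs no regularity of \<open>q\<close>.\<close>
    define G where "G n t = (\<Sum>i\<in>I. q i t * ((\<psi> i (t + h n) - \<psi> i t) / h n))" for n t
    have sub: "{x..y} \<subseteq> {lo..hi}" using xy by auto
    have measxy: "q i \<in> borel_measurable (restrict_space borel {x..y})" if "i \<in> I" for i
      using meas[OF that] sub by (rule measurable_restrict_mono)
    have contG: "continuous_on {x..y} (\<lambda>t. (\<psi> i (t + h n) - \<psi> i t) / h n)" if "i \<in> I" for i n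
      by (intro continuous_intros continuous_on_compose2[OF \<psi>_cont[OF that]]
          continuous_on_subset[OF \<psi>_cont[OF that] sub])
         (use h_mem h_nz in auto)
    have bdG: "\<bar>(\<psi> i (t + h n) - \<psi> i t) / h n\<bar> \<le> L i" if "i \<in> I" "t \<in> {x..y}" for i n t
      using L[OF that(1), of t "t + h n"] h_mem[OF that(2)] that(2) sub h_nz[of n]
      by (auto simp: divide_simps)
    have G_int: "G n integrable_on {x..y}"
      and G_bd: "\<And>t. t \<in> {x..y} \<Longrightarrow> norm (G n t) \<le> K" for n
      unfolding G_def K_def
      by (rule bounded_borel_sum_integrable[where B=B]; use measxy bdd sub contG bdG B0 in blast)+
    have G_lim: "(\<lambda>n. G n t) \<longlonglongrightarrow> ?u t" if t: "t \<in> {x..y}" for t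
      unfolding G_def
    proof (intro tendsto_sum tendsto_mult_left)
      fix i assume "i \<in> I"
      then have "(\<psi> i has_real_derivative \<psi>' i t) (at t)"
        using deriv[of i t] t xy by (auto simp: at_within_Icc_at)
      then show "(\<lambda>n. (\<psi> i (t + h n) - \<psi> i t) / h n) \<longlonglongrightarrow> \<psi>' i t"
        using filterlim_compose[OF _ h_lim] by (force simp: DERIV_def)
    qed
    have lim1: "(\<lambda>n. \<sigma> * integral {x..y} (G n)) \<longlonglongrightarrow> \<sigma> * integral {x..y} ?u"
      by (intro tendsto_mult_left dominated_convergence(2)[where h="\<lambda>_. K"] G_int G_lim) (use G_bd in auto)
    have quot: "(\<lambda>n. (P (t + h n) - P t) / h n) \<longlonglongrightarrow> W t" if "t \<in> {x, y}" for t
      using P_deriv[of t] that xy filterlim_compose[OF _ h_lim] by (force simp: DERIV_def)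
    have lim2: "(\<lambda>n. \<sigma> * ((P (y + h n) - P y) / h n - (P (x + h n) - P x) / h n)) \<longlonglongrightarrow> \<sigma> * (W y - W x)"
      by (intro tendsto_mult_left tendsto_diff quot) auto
    have Wint: "W integrable_on {c..d}" if "lo \<le> c" "d \<le> hi" for c d
      using W_cont continuous_on_subset that by (intro integrable_continuous_real) (auto intro: continuous_on_subset)
    have Pdiff: "integral {c..d} W = P d - P c" if "lo \<le> c" "c \<le> d" "d \<le> hi" for c d
      using Henstock_Kurzweil_Integration.integral_combine[of lo c d W] Wint[of lo d] that
      by (auto simp: P_def)
    have le: "\<sigma> * integral {x..y} (G n) \<le> \<sigma> * ((P (y + h n) - P y) / h n - (P (x + h n) - P x) / h n)" for n
    proof -
      have cont_shift: "continuous_on {x..y} (\<lambda>t. W (t + h n))"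
        by (intro continuous_on_compose2[OF W_cont] continuous_intros) (use h_mem in auto)
      have "integral {x..y} (\<lambda>t. W (t + h n)) = integral {x + h n..y + h n} W"
        using integral_shift_real_ivl[of "x + h n" "h n" "y + h n" W] by simp
      also have "\<dots> = P (y + h n) - P (x + h n)"
        using h_mem[of x n] h_mem[of y n] xy by (intro Pdiff) auto
      finally have I1: "integral {x..y} (\<lambda>t. W (t + h n)) = P (y + h n) - P (x + h n)" .
      have I2: "integral {x..y} (\<lambda>t. (\<sigma> / h n) * (W (t + h n) - W t)) =
          (\<sigma> / h n) * ((P (y + h n) - P (x + h n)) - (P y - P x))"
        using I1 Pdiff[of x y] xy Wint[of x y] integrable_continuous_real[OF cont_shift]
        by (simp add: Henstock_Kurzweil_Integration.integral_diff)
      have "integral {x..y} (\<lambda>t. \<sigma> * G n t) \<le> integral {x..y} (\<lambda>t. (\<sigma> / h n) * (W (t + h n) - W t))"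
      proof (rule integral_le)
        show "(\<lambda>t. \<sigma> * G n t) integrable_on {x..y}"
          using G_int by (rule integrable_on_mult_right)
        show "(\<lambda>t. (\<sigma> / h n) * (W (t + h n) - W t)) integrable_on {x..y}"
          using cont_shift continuous_on_subset[OF W_cont sub]
          by (intro integrable_continuous_real continuous_intros)
        fix t assume t: "t \<in> {x..y}"
        then have t': "t \<in> {lo..hi}" using sub by auto
        have "\<sigma> * G n t = (\<sigma> / h n) * ((\<Sum>i\<in>I. q i t * \<psi> i (t + h n)) - W t)"
          by (simp add: G_def W[OF t'] sum_subtractf[symmetric] sum_distrib_left right_diff_distrib diff_divide_distrib mult.assoc)
        \<comment> \<open>\<open>\<sigma> / h n\<close> is positive for either sign of the shift, so
          the supporting inequality keeps its direction.\<close>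
        also have "\<dots> \<le> (\<sigma> / h n) * (W (t + h n) - W t)"
          using support[OF t' h_mem[OF t, of n]] unfolding h_inv by (intro mult_left_mono) auto
        finally show "\<sigma> * G n t \<le> (\<sigma> / h n) * (W (t + h n) - W t)" .
      qed
      then show ?thesis
        unfolding I2 by (simp add: algebra_simps diff_divide_distrib)
    qed
    show ?thesis
      by (rule LIMSEQ_le[OF lim1 lim2]) (use le in blast)
  qed
  have inner: "integral {x..y} ?u = W y - W x" if "lo < x" "x < y" "y < hi" for x y
    using key[OF that, of 1] key[OF that, of "-1"] by simp
  \<comment> \<open>Shifting left no room at the ends; \<open>D\<close> is constant in the interior
    and continuous, hence constant up to the ends.\<close>
  define D where "D = (\<lambda>t. integral {lo..t} ?u - W t)"
  have D_cont: "continuous_on (closure {lo<..<hi}) D"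
    using \<open>lo < hi\<close> u_int W_cont unfolding D_def
    by (auto intro!: continuous_intros indefinite_integral_continuous_1)
  have D_diff: "D x = D y" if "lo < x" "x < y" "y < hi" for x y
    using inner[OF that] Henstock_Kurzweil_Integration.integral_combine[of lo x y ?u]
      integrable_subinterval_real[OF u_int, of lo y] that
    by (auto simp: D_def)
  obtain m where m: "lo < m" "m < hi"
    using dense[OF \<open>lo < hi\<close>] by blast
  have "D t = D m" if "t \<in> {lo<..<hi}" for t
    using D_diff[of t m] D_diff[of m t, symmetric] that m
    by (metis greaterThanLessThan_iff linorder_neqE_linordered_idom)
  then have "D t = D m" if "t \<in> {lo..hi}" for t
    by (rule continuous_constant_on_closure[OF D_cont]) (use that \<open>lo < hi\<close> in auto)
  then have "D hi = D lo"
    using \<open>lo < hi\<close> by (metis atLeastAtMost_iff less_imp_le order_refl)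
  then have "integral {lo..hi} ?u = W hi - W lo"
    by (simp add: D_def)
  with u_int show ?thesis
    by (metis integrable_integral)
qed

subsection \<open>Single crossing\<close>

text \<open>In either direction of monotonicity, the sign at \<open>y\<close> lies between the signs
  at \<open>x\<close> and \<open>z\<close>.\<close>

lemma single_crossing_no_return:
  assumes "single_crossing_on T g" and "x \<in> T" "y \<in> T" "z \<in> T" and "x \<le> y" "y \<le> z"
    and "g x > 0" "g z > 0"
  shows "g y > 0"
proof -
  consider "sgn (g x) \<le> sgn (g y)" | "sgn (g z) \<le> sgn (g y)"
    using assms unfolding single_crossing_on_def monotonic_on_def monotone_on_def by blast
  then show ?thesis
    using assms(7,8) by cases (auto simp: sgn_if split: if_splits)
qed

lemma single_crossing_up:
  assumes "single_crossing_on T g" and "x \<in> T" "y \<in> T" and "x \<le> y" and "g x < 0" "g y > 0"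
  shows "mono_on T (\<lambda>t. sgn (g t))"
proof -
  have "\<not> antimono_on T (\<lambda>t. sgn (g t))"
  proof
    assume "antimono_on T (\<lambda>t. sgn (g t))"
    then have "sgn (g y) \<le> sgn (g x)"
      using assms unfolding monotone_on_def by blast
    with assms show False by simp
  qed
  with assms show ?thesis
    by (simp add: single_crossing_on_def monotonic_on_def)
qed

text \<open>If \<open>r t3\<close> were nonzero, the values at the three points would form a
  triangular matrix with nonzero diagonal. Some combination would then have signs +, -, + in the
  order of the points, against single crossing.\<close>

lemma single_crossing_three_points:
  fixes p q r :: "real \<Rightarrow> real"
  assumes sc: "\<And>x y z. single_crossing_on T (\<lambda>t. x * p t + y * q t + z * r t)"
    and T: "t1 \<in> T" "t2 \<in> T" "t3 \<in> T"
    and p: "p t1 \<noteq> 0" and q: "q t1 = 0" "q t2 \<noteq> 0" and r: "r t1 = 0" "r t2 = 0"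
  shows "r t3 = 0"
proof (rule ccontr)
  assume r3: "r t3 \<noteq> 0"
  have interp: "\<exists>g. single_crossing_on T g \<and> g t1 = u1 \<and> g t2 = u2 \<and> g t3 = u3" for u1 u2 u3
  proof -
    \<comment> \<open>Forward substitution in the triangular system.\<close>
    define x where "x = u1 / p t1"
    define y where "y = (u2 - x * p t2) / q t2"
    define z where "z = (u3 - x * p t3 - y * q t3) / r t3"
    have "single_crossing_on T (\<lambda>t. x * p t + y * q t + z * r t)" by (rule sc)
    moreover have "x * p t1 + y * q t1 + z * r t1 = u1" "x * p t2 + y * q t2 + z * r t2 = u2"
      "x * p t3 + y * q t3 + z * r t3 = u3"
      using p q r r3 by (simp_all add: x_def y_def z_def)
    ultimately show ?thesis by metis
  qed
  have no: "\<not> (s1 < s2 \<and> s2 < s3)"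
    if "s1 \<in> T" "s2 \<in> T" "s3 \<in> T" "single_crossing_on T g" "g s1 = 1" "g s2 = -1" "g s3 = 1" for s1 s2 s3 g
    using single_crossing_no_return[OF that(4,1,2,3)] that(5-7) by auto
  have "t1 \<noteq> t2" "t1 \<noteq> t3" "t2 \<noteq> t3"
    using q r r3 by auto
  \<comment> \<open>The cases say which point lies in the middle; that point receives the value
    -1.\<close>
  then consider "t1 < t2 \<and> t2 < t3 \<or> t3 < t2 \<and> t2 < t1" | "t2 < t1 \<and> t1 < t3 \<or> t3 < t1 \<and> t1 < t2"
    | "t1 < t3 \<and> t3 < t2 \<or> t2 < t3 \<and> t3 < t1"
    by linarith
  then show False
  proof cases
    case 1 then show False using interp[of 1 "-1" 1] no T by blast
  next
    case 2 then show False using interp[of "-1" 1 1] no T by blast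
  next
    case 3 then show False using interp[of 1 1 "-1"] no T by blast
  qed
qed

subsection \<open>Values and the type distribution\<close>

context bundling_setup
begin

lemma v_has_derivative: "t \<in> types \<Longrightarrow> (v b has_real_derivative v_t b t) (at t within types)"
  using value_differentiable[of b]
  unfolding v_t_def differentiable_on_def has_real_derivative_iff_has_vector_derivative
  by (simp add: vector_derivative_works)

lemma v_continuous: "continuous_on types (v b)"
  using v_has_derivative by (meson DERIV_continuous_on)

lemma lo_in_types [simp]: "lo \<in> types" and hi_in_types [simp]: "hi \<in> types"
  using lo_less_hi by (auto simp: types_def)

lemma density_measurable: "(\<lambda>t. indicator types t * f t) \<in> borel_measurable borel"
  using borel_measurable_continuous_on_indicator[OF _ density_continuous] by (simp add: types_def)

lemma LINT_type_dist:
  assumes "g \<in> borel_measurable borel"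
  shows "integral\<^sup>L type_dist g = (LBINT t:types. f t * g t)"
  unfolding type_dist_def set_lebesgue_integral_def
  using assms density_measurable density_pos
  by (subst integral_density) (auto simp: indicator_def less_imp_le mult.assoc)

lemma F_eq:
  assumes "t \<in> types"
  shows "F t = integral {lo..t} f"
proof -
  interpret prob_space type_dist by (rule prob_space_type_dist)
  have sub: "{lo..t} \<subseteq> types" using assms by (auto simp: types_def)
  have "F t = integral\<^sup>L type_dist (indicator {..t})"
    by (simp add: F_def cdf_def2 type_dist_def)
  also have "\<dots> = (LBINT s:types. f s * indicator {..t} s)"
    by (intro LINT_type_dist) auto
  also have "\<dots> = (LBINT s:{lo..t}. f s)"
    unfolding set_lebesgue_integral_def
    by (intro Bochner_Integration.integral_cong) (use assms in \<open>auto simp: indicator_def types_def\<close>)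
  also have "\<dots> = integral {lo..t} f"
    by (intro set_borel_integral_eq_integral borel_integrable_atLeastAtMost'
        continuous_on_subset[OF density_continuous sub])
  finally show ?thesis .
qed

lemma F_has_derivative:
  assumes t: "t \<in> types"
  shows "(F has_real_derivative f t) (at t within types)"
  using integral_has_real_derivative[OF density_continuous[unfolded types_def] t[unfolded types_def]]
  unfolding types_def[symmetric]
  by (rule has_field_derivative_transform_within[OF _ zero_less_one t]) (simp add: F_eq)

lemma F_continuous: "continuous_on types F"
  using F_has_derivative by (meson DERIV_continuous_on)

lemma F_lo: "F lo = 0"
  by (simp add: F_eq)

lemma F_hi: "F hi = 1"
proof -
  interpret prob_space type_dist by (rule prob_space_type_dist)
  have "F hi = integral\<^sup>L type_dist (\<lambda>_. 1)"
    unfolding F_eq[OF hi_in_types]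
    by (subst LINT_type_dist)
      (auto simp: types_def intro!: set_borel_integral_eq_integral(2)[symmetric]
        borel_integrable_atLeastAtMost' density_continuous[unfolded types_def])
  then show ?thesis using prob_space by simp
qed

lemma F_mono: "mono F"
proof -
  interpret prob_space type_dist by (rule prob_space_type_dist)
  show ?thesis
    unfolding F_def cdf_def
    by (intro monoI finite_measure_mono) (auto simp: type_dist_def)
qed

lemma F_le_1: "t \<in> types \<Longrightarrow> F t \<le> 1"
  using F_mono F_hi by (metis atLeastAtMost_iff monoD types_def)

lemma \<phi>_continuous: "continuous_on types (\<phi> b)"
  unfolding \<phi>_def using density_pos
  by (intro continuous_intros v_continuous F_continuous density_continuous value_deriv_continuous) force

lemma \<phi>_hi: "\<phi> b hi = v b hi"
  by (simp add: \<phi>_def F_hi)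

text \<open>\<open>v {}\<close> is known only on \<open>types\<close>, so its derivative comes from
  uniqueness of derivatives within a nondegenerate closed interval.\<close>

lemma \<phi>_empty:
  assumes "t \<in> types"
  shows "\<phi> {} t = 0"
proof -
  have "((\<lambda>_. 0) has_real_derivative v_t {} t) (at t within types)"
    using v_has_derivative[OF assms, of "{}"] zero_less_one assms
    by (rule has_field_derivative_transform_within) (simp add: value_empty)
  then have "v_t {} t = 0"
    using vector_derivative_unique_within_closed_interval[of lo hi t "\<lambda>_. 0 :: real" "v_t {} t" 0]
      lo_less_hi assms
    by (simp add: has_real_derivative_iff_has_vector_derivative types_def)
  then show ?thesis
    by (simp add: \<phi>_def value_empty assms)
qed

lemma value_sto_eq: "value_sto a t = (\<Sum>b\<in>UNIV. pmf a b * v b t)"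
  unfolding value_sto_def by (subst integral_measure_pmf[of UNIV]) auto

lemma \<phi>_sto_eq: "\<phi>_sto a t = (\<Sum>b\<in>UNIV. pmf a b * \<phi> b t)"
  unfolding \<phi>_sto_def by (subst integral_measure_pmf[of UNIV]) auto

lemma value_sto_return [simp]: "value_sto (return_pmf b) t = v b t"
  by (simp add: value_sto_def)

lemma \<phi>_sto_return [simp]: "\<phi>_sto (return_pmf b) t = \<phi> b t"
  by (simp add: \<phi>_sto_def)

subsection \<open>Revenue equivalence\<close>

lemma value_sto_bounded: "\<exists>C. \<forall>a. \<forall>t\<in>types. \<bar>value_sto a t\<bar> \<le> C"
proof -
  have "bounded (v b ` types)" for b
    using compact_continuous_image[OF v_continuous] by (simp add: compact_imp_bounded types_def)
  then have "\<forall>b. \<exists>C. \<forall>t\<in>types. \<bar>v b t\<bar> \<le> C"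
    by (auto simp: bounded_iff)
  then obtain C where C: "\<And>b t. t \<in> types \<Longrightarrow> \<bar>v b t\<bar> \<le> C b"
    by metis
  have "\<bar>value_sto a t\<bar> \<le> (\<Sum>b\<in>UNIV. C b)" if t: "t \<in> types" for a t
  proof -
    have "\<bar>value_sto a t\<bar> \<le> (\<Sum>b\<in>UNIV. \<bar>pmf a b * v b t\<bar>)"
      unfolding value_sto_eq by (rule sum_abs)
    also have "\<dots> \<le> (\<Sum>b\<in>UNIV. C b)"
    proof (rule sum_mono)
      fix b
      have "\<bar>pmf a b * v b t\<bar> \<le> 1 * C b"
        unfolding abs_mult using C[OF t, of b] pmf_le_1[of a b] by (intro mult_mono) auto
      then show "\<bar>pmf a b * v b t\<bar> \<le> C b" by simp
    qed
    finally show ?thesis .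
  qed
  then show ?thesis by blast
qed

text \<open>IR bounds the payment from above; IC of type \<open>lo\<close> against imitating
  \<open>t\<close> bounds it from below.\<close>

lemma feasible_payment_bounded:
  assumes "feasible a p"
  shows "\<exists>B. \<forall>t\<in>types. \<bar>p t\<bar> \<le> B"
proof -
  obtain C where C: "\<And>a t. t \<in> types \<Longrightarrow> \<bar>value_sto a t\<bar> \<le> C"
    using value_sto_bounded by blast
  have "\<bar>p t\<bar> \<le> 2 * C + \<bar>p lo\<bar>" if t: "t \<in> types" for t
  proof -
    have "value_sto (a t) t - p t \<ge> 0" "value_sto (a lo) lo - p lo \<ge> value_sto (a t) lo - p t"
      using assms t by (auto simp: feasible_def IC_def IR_def)
    with C[OF t, of "a t"] C[OF lo_in_types, of "a lo"] C[OF lo_in_types, of "a t"]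
    show ?thesis by linarith
  qed
  then show ?thesis by blast
qed

lemma revenue_eq_integral:
  assumes p: "p \<in> borel_measurable (restrict_space borel types)"
    and B: "\<And>t. t \<in> types \<Longrightarrow> \<bar>p t\<bar> \<le> B"
  shows "revenue p = integral types (\<lambda>t. f t * p t)"
proof -
  have "bounded (f ` types)"
    using compact_continuous_image[OF density_continuous] by (simp add: compact_imp_bounded types_def)
  then obtain C where C: "\<And>t. t \<in> types \<Longrightarrow> \<bar>f t\<bar> \<le> C"
    by (auto simp: bounded_iff)
  \<comment> \<open>The indicator turns \<open>p\<close>, controlled only on \<open>types\<close>,
    into a Borel function on the whole line.\<close>
  have "revenue p = (LBINT t:types. f t * (indicator types t *\<^sub>R p t))"
    unfolding revenue_def set_lebesgue_integral_def[of type_dist]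
    using p by (intro LINT_type_dist) (subst (asm) borel_measurable_restrict_space_iff, auto simp: types_def)
  also have "\<dots> = (LBINT t:types. f t * p t)"
    unfolding set_lebesgue_integral_def
    by (intro Bochner_Integration.integral_cong) (auto simp: indicator_def)
  also have "\<dots> = integral types (\<lambda>t. f t * p t)"
    unfolding types_def
  proof (intro set_borel_integral_eq_integral bounded_borel_set_integrable)
    show "(\<lambda>t. f t * p t) \<in> borel_measurable (restrict_space borel {lo..hi})"
      using p borel_measurable_continuous_on_restrict[OF density_continuous] unfolding types_def
      by (intro borel_measurable_times)
    show "\<bar>f t * p t\<bar> \<le> C * B" if "t \<in> {lo..hi}" for t
      using C[of t] B[of t] that unfolding abs_mult types_def by (intro mult_mono) auto
  qed
  finally show ?thesis .
qed

text \<open>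
  The envelope theorem is applied to \<open>(1 - F)\<close> times the information rent, a combination of the
  functions \<open>(1 - F) v b\<close> and \<open>1 - F\<close> with derivatives \<open>- f \<phi> b\<close> and \<open>- f\<close>; the price is
  the weight of \<open>None\<close>.
\<close>

lemma feasible_revenue:
  assumes feas: "feasible a p"
  shows "(\<lambda>t. f t * \<phi>_sto (a t) t) integrable_on types"
    and "revenue p = integral types (\<lambda>t. f t * \<phi>_sto (a t) t) - (value_sto (a lo) lo - p lo)"
proof -
  obtain B where B: "\<And>t. t \<in> types \<Longrightarrow> \<bar>p t\<bar> \<le> B"
    using feasible_payment_bounded[OF feas] by blast
  define \<psi> where "\<psi> = case_option (\<lambda>t. 1 - F t) (\<lambda>b t. (1 - F t) * v b t)"
  define \<psi>' where "\<psi>' = case_option (\<lambda>t. - f t) (\<lambda>b t. - (f t * \<phi> b t))"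
  define q where "q = case_option (\<lambda>t. - p t) (\<lambda>b t. pmf (a t) b)"
  define W where "W t = (1 - F t) * (value_sto (a t) t - p t)" for t
  have option_sum: "(\<Sum>i\<in>UNIV. g i) = g None + (\<Sum>b\<in>UNIV. g (Some b))" for g :: "'g set option \<Rightarrow> real"
    unfolding UNIV_option_conv by (subst sum.insert) (auto simp: sum.reindex)
  \<comment> \<open>The weights of \<open>s\<close> at \<open>t\<close> give the payoff of type
    \<open>t\<close> from reporting \<open>s\<close>, times the nonnegative \<open>1 - F t\<close>;
    the supporting inequality is thus IC.\<close>
  have combo: "(\<Sum>i\<in>UNIV. q i s * \<psi> i t) = (1 - F t) * (value_sto (a s) t - p s)" for s t
    by (simp add: option_sum q_def \<psi>_def value_sto_eq right_diff_distrib sum_distrib_left algebra_simps)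
  have combo': "(\<Sum>i\<in>UNIV. q i t * \<psi>' i t) = f t * p t - f t * \<phi>_sto (a t) t" for t
    by (simp add: option_sum q_def \<psi>'_def \<phi>_sto_eq sum_distrib_left sum_negf algebra_simps)
  have meas: "q i \<in> borel_measurable (restrict_space borel {lo..hi})" for i
    using feas by (cases i) (auto simp: q_def feasible_def mechanism_def types_def)
  have "((\<lambda>t. \<Sum>i\<in>UNIV. q i t * \<psi>' i t) has_integral (W hi - W lo)) {lo..hi}"
  proof (rule envelope_has_integral)
    fix i :: "'g set option" and t assume t: "t \<in> {lo..hi}"
    have "((\<lambda>t. 1 - F t) has_real_derivative - f t) (at t within {lo..hi})"
      using F_has_derivative[of t] t by (auto intro!: derivative_eq_intros simp: types_def)
    moreover have "((\<lambda>t. (1 - F t) * v b t) has_real_derivative - (f t * \<phi> b t)) (at t within {lo..hi})" for b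
      using F_has_derivative[of t] v_has_derivative[of t b] density_pos[of t] t unfolding types_def[symmetric]
      by (auto intro!: derivative_eq_intros simp: \<phi>_def field_simps)
    ultimately show "(\<psi> i has_real_derivative \<psi>' i t) (at t within {lo..hi})"
      by (cases i) (auto simp: \<psi>_def \<psi>'_def)
  next
    fix i :: "'g set option"
    show "continuous_on {lo..hi} (\<psi>' i)"
      using density_continuous \<phi>_continuous
      by (cases i) (auto simp: \<psi>'_def types_def intro!: continuous_intros)
  next
    fix i :: "'g set option" and t assume "t \<in> {lo..hi}"
    then show "\<bar>q i t\<bar> \<le> max B 1"
      using B[of t] pmf_le_1[of "a t"] by (cases i) (auto simp: q_def types_def le_max_iff_disj)
  next
    fix s t assume "s \<in> {lo..hi}" "t \<in> {lo..hi}"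
    then have st: "s \<in> types" "t \<in> types" by (auto simp: types_def)
    then show "(\<Sum>i\<in>UNIV. q i s * \<psi> i t) \<le> W t"
      unfolding combo W_def using feas F_le_1[of t]
      by (intro mult_left_mono) (auto simp: feasible_def IC_def)
  qed (use meas lo_less_hi combo in \<open>auto simp: W_def\<close>)
  \<comment> \<open>\<open>F hi = 1\<close> makes \<open>W hi\<close> vanish, and
    \<open>F lo = 0\<close> makes \<open>W lo\<close> the rent of the lowest type.\<close>
  then have I: "((\<lambda>t. f t * p t - f t * \<phi>_sto (a t) t) has_integral (- (value_sto (a lo) lo - p lo))) types"
    unfolding combo' by (simp add: W_def F_hi F_lo types_def)
  obtain C where C: "\<And>b t. t \<in> types \<Longrightarrow> \<bar>f t * \<phi> b t\<bar> \<le> C b"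
  proof -
    have "bounded ((\<lambda>t. f t * \<phi> b t) ` types)" for b
      by (intro compact_imp_bounded compact_continuous_image continuous_intros density_continuous \<phi>_continuous)
        (simp add: types_def)
    then have "\<forall>b. \<exists>C. \<forall>t\<in>types. \<bar>f t * \<phi> b t\<bar> \<le> C"
      by (auto simp: bounded_iff)
    then show ?thesis using that by metis
  qed
  have eq: "(\<lambda>t. f t * \<phi>_sto (a t) t) = (\<lambda>t. \<Sum>b\<in>UNIV. pmf (a t) b * (f t * \<phi> b t))"
    by (simp add: \<phi>_sto_eq sum_distrib_left ac_simps)
  show int: "(\<lambda>t. f t * \<phi>_sto (a t) t) integrable_on types"
    unfolding eq types_def
  proof (rule bounded_borel_sum_integrable[where B=1 and C=C])
    show "(\<lambda>t. pmf (a t) b) \<in> borel_measurable (restrict_space borel {lo..hi})" for b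
      using feas by (auto simp: feasible_def mechanism_def types_def)
    show "continuous_on {lo..hi} (\<lambda>t. f t * \<phi> b t)" for b
      using density_continuous \<phi>_continuous[of b] by (auto simp: types_def intro!: continuous_intros)
  qed (use C in \<open>auto simp: types_def pmf_le_1\<close>)
  have "((\<lambda>t. f t * p t) has_integral
      (- (value_sto (a lo) lo - p lo) + integral types (\<lambda>t. f t * \<phi>_sto (a t) t))) types"
    using has_integral_add[OF I integrable_integral[OF int]] by simp
  moreover have "revenue p = integral types (\<lambda>t. f t * p t)"
    using feas B by (intro revenue_eq_integral) (auto simp: feasible_def mechanism_def)
  ultimately show "revenue p = integral types (\<lambda>t. f t * \<phi>_sto (a t) t) - (value_sto (a lo) lo - p lo)"
    by (simp add: integral_unique)
qed

end

section \<open>Linear combinations of virtual values\<close>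

locale bundling_crossing = bundling_setup lo hi f v
  for lo hi :: real
    and f :: "real \<Rightarrow> real"
    and v :: "'g::finite set \<Rightarrow> real \<Rightarrow> real" +
  assumes value_monotonic: "monotonic_on types (\<lambda>t. v b t - v b' t)"
    and virtual_sto_crossing: "single_crossing_on types (\<lambda>t. \<phi>_sto a t - \<phi>_sto a' t)"
begin

definition virtual_span :: "(real \<Rightarrow> real) set" where
  "virtual_span = range (\<lambda>c t. \<Sum>b\<in>UNIV. c b * \<phi> b t)"

lemma virtual_span_\<phi>: "\<phi> b \<in> virtual_span"
  unfolding virtual_span_def
  by (rule range_eqI[of _ _ "\<lambda>b'. if b' = b then 1 else 0"]) (simp add: fun_eq_iff if_distrib[of "\<lambda>x. x * _"] cong: if_cong)

lemma virtual_span_add: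
  assumes "p \<in> virtual_span" "q \<in> virtual_span"
  shows "(\<lambda>t. p t + q t) \<in> virtual_span"
proof -
  obtain c d where "p = (\<lambda>t. \<Sum>b\<in>UNIV. c b * \<phi> b t)" "q = (\<lambda>t. \<Sum>b\<in>UNIV. d b * \<phi> b t)"
    using assms by (auto simp: virtual_span_def)
  then show ?thesis
    unfolding virtual_span_def
    by (intro range_eqI[of _ _ "\<lambda>b. c b + d b"]) (simp add: fun_eq_iff sum.distrib distrib_right)
qed

lemma virtual_span_scale:
  assumes "p \<in> virtual_span"
  shows "(\<lambda>t. x * p t) \<in> virtual_span"
proof -
  obtain c where "p = (\<lambda>t. \<Sum>b\<in>UNIV. c b * \<phi> b t)"
    using assms by (auto simp: virtual_span_def)
  then show ?thesis
    unfolding virtual_span_def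
    by (intro range_eqI[of _ _ "\<lambda>b. x * c b"]) (simp add: fun_eq_iff sum_distrib_left mult.assoc)
qed

lemma virtual_span_diff:
  "p \<in> virtual_span \<Longrightarrow> q \<in> virtual_span \<Longrightarrow> (\<lambda>t. p t - q t) \<in> virtual_span"
  using virtual_span_add[OF _ virtual_span_scale[of q "-1"], of p] by simp

text \<open>
  Positive and negative part of the coefficients become two lotteries after rescaling, the missing
  probability being put on the empty bundle, whose virtual value is zero.
\<close>

lemma virtual_span_single_crossing:
  assumes "g \<in> virtual_span"
  shows "single_crossing_on types g"
proof -
  obtain c where c: "g = (\<lambda>t. \<Sum>b\<in>UNIV. c b * \<phi> b t)"
    using assms by (auto simp: virtual_span_def)
  \<comment> \<open>Dividing by \<open>N\<close> brings the total weight to at most one; the summand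
    1 keeps \<open>N\<close> positive when all coefficients vanish.\<close>
  define N where "N = 1 + (\<Sum>b\<in>UNIV. \<bar>c b\<bar>)"
  have N: "N > 0" by (simp add: N_def add_pos_nonneg sum_nonneg)
  have lottery: "\<exists>a. \<forall>t\<in>types. \<phi>_sto a t = (\<Sum>b\<in>UNIV. w b * \<phi> b t) / N"
    if w: "\<And>b. 0 \<le> w b" "\<And>b. w b \<le> \<bar>c b\<bar>" for w
  proof -
    define q where "q b = (if b = {} then 1 - (\<Sum>b\<in>-{{}}. w b / N) else w b / N)" for b
    have "(\<Sum>b\<in>-{{}}. w b / N) \<le> (\<Sum>b\<in>UNIV. \<bar>c b\<bar> / N)"
      using w N by (intro sum_mono2 order_trans[OF sum_mono sum_mono2]) (auto simp: divide_right_mono)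
    also have "\<dots> \<le> 1"
      using N by (simp add: sum_divide_distrib[symmetric] N_def)
    finally have q0: "q b \<ge> 0" for b
      using w N by (simp add: q_def)
    have UNIV_eq: "(UNIV :: 'g set set) = insert {} (-{{}})" by auto
    have "(\<Sum>b\<in>UNIV. q b) = 1"
      unfolding UNIV_eq by (subst sum.insert) (auto simp: q_def)
    then have "(\<integral>\<^sup>+ b. ennreal (q b) \<partial>count_space UNIV) = 1"
      using q0 by (simp add: nn_integral_count_space_finite sum_ennreal)
    then have pmf_q: "pmf (embed_pmf q) b = q b" for b
      using q0 by (intro pmf_embed_pmf) auto
    have "\<phi>_sto (embed_pmf q) t = (\<Sum>b\<in>UNIV. w b * \<phi> b t) / N" if t: "t \<in> types" for t
      unfolding \<phi>_sto_eq pmf_q sum_divide_distrib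
      by (intro sum.cong) (auto simp: q_def \<phi>_empty[OF t])
    then show ?thesis by blast
  qed
  obtain a where a: "\<And>t. t \<in> types \<Longrightarrow> \<phi>_sto a t = (\<Sum>b\<in>UNIV. max (c b) 0 * \<phi> b t) / N"
    using lottery[of "\<lambda>b. max (c b) 0"] by force
  obtain a' where a': "\<And>t. t \<in> types \<Longrightarrow> \<phi>_sto a' t = (\<Sum>b\<in>UNIV. max (- c b) 0 * \<phi> b t) / N"
    using lottery[of "\<lambda>b. max (- c b) 0"] by force
  have "sgn (g t) = sgn (\<phi>_sto a t - \<phi>_sto a' t)" if "t \<in> types" for t
  proof -
    have "g t = N * (\<phi>_sto a t - \<phi>_sto a' t)"
      unfolding a[OF that] a'[OF that] c diff_divide_distrib[symmetric] sum_subtractf[symmetric]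
      using N by (auto intro!: sum.cong simp: max_def left_diff_distrib[symmetric])
    with N show ?thesis by (simp add: sgn_mult)
  qed
  with virtual_sto_crossing[of a a'] show ?thesis
    unfolding single_crossing_on_def monotonic_on_def monotone_on_def by metis
qed

lemma \<phi>_diff_crossing: "single_crossing_on types (\<lambda>t. \<phi> b t - \<phi> b' t)"
  by (intro virtual_span_single_crossing virtual_span_diff virtual_span_\<phi>)

subsection \<open>Strict maximizers of the virtual value\<close>

definition core_menu :: "'g set set" where
  "core_menu = {b. \<exists>t\<in>types. \<forall>b'. b' \<noteq> b \<longrightarrow> \<phi> b' t < \<phi> b t}"

lemma empty_in_core: "{} \<in> core_menu"
  using virtual_lo_neg by (auto simp: core_menu_def \<phi>_empty intro!: bexI[of _ lo])

text \<open>
  By the three point lemma, differences of virtual values of bundles tied at \<open>t1\<close> with a positive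
  virtual value are all proportional, so their zero set is common, and
  single crossing makes no other bundle catch up on it. Just
  outside this zero set one of the tied bundles is the strict maximizer.
\<close>

lemma core_menu_attains_max:
  assumes t1: "t1 \<in> types"
  shows "\<exists>b\<in>core_menu. \<forall>b'. \<phi> b' t1 \<le> \<phi> b t1"
proof (cases "\<forall>b'. \<phi> b' t1 \<le> \<phi> {} t1")
  case True
  then show ?thesis using empty_in_core by blast
next
  case False
  define K where "K = {b. \<forall>b'. \<phi> b' t1 \<le> \<phi> b t1}"
  obtain b where b: "b \<in> K"
  proof -
    have "Max (range (\<lambda>b. \<phi> b t1)) \<in> range (\<lambda>b. \<phi> b t1)" by (intro Max_in) auto
    then obtain b where "\<phi> b t1 = Max (range (\<lambda>b. \<phi> b t1))" by (metis (no_types, lifting) imageE)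
    then show ?thesis using that[of b] by (auto simp: K_def)
  qed
  have pos: "\<phi> b t1 > 0"
  proof -
    obtain x where "\<phi> x t1 > 0" using False \<phi>_empty[OF t1] by (auto simp: not_le)
    with b show ?thesis by (auto simp: K_def intro: less_le_trans)
  qed
  show ?thesis
  proof (cases "K = {b}")
    case True
    have "\<phi> e t1 < \<phi> b t1" if "e \<noteq> b" for e
    proof -
      have "e \<notin> K" using True that by auto
      then obtain x where "\<phi> e t1 < \<phi> x t1" by (auto simp: K_def not_le)
      with b show ?thesis by (auto simp: K_def intro: less_le_trans)
    qed
    then have "b \<in> core_menu" using t1 by (auto simp: core_menu_def)
    with b show ?thesis by (auto simp: K_def)
  next
    case False
    then obtain b' where b': "b' \<in> K" "b' \<noteq> b" using b by blast
    define D where "D = (\<lambda>t. \<phi> b t - \<phi> b' t)"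
    obtain t2 where t2: "t2 \<in> types" "D t2 \<noteq> 0"
      using virtual_distinct[of b b'] b' by (auto simp: D_def)
    have D1: "D t1 = 0"
      using b b' by (auto simp: D_def K_def intro: antisym)
    have D_span: "D \<in> virtual_span"
      unfolding D_def by (intro virtual_span_diff virtual_span_\<phi>)
    \<comment> \<open>The factor is forced by the value at \<open>t2\<close>; the remainder
      \<open>r\<close> then vanishes at \<open>t1\<close> and \<open>t2\<close>, as the three point
      lemma requires.\<close>
    define c where "c k = (\<phi> b t2 - \<phi> k t2) / D t2" for k
    have proportional: "\<phi> b t - \<phi> k t = c k * D t" if k: "k \<in> K" and t: "t \<in> types" for k t
    proof -
      define r where "r = (\<lambda>t. (\<phi> b t - \<phi> k t) - c k * D t)"
      have r_span: "r \<in> virtual_span"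
        unfolding r_def by (intro virtual_span_diff virtual_span_scale virtual_span_\<phi> D_span)
      have "\<phi> b t1 = \<phi> k t1" using b k by (auto simp: K_def intro: antisym)
      then have "r t1 = 0" "r t2 = 0" using D1 t2 by (simp_all add: r_def c_def)
      then have "r t = 0"
        using single_crossing_three_points[of types "\<phi> b" D r t1 t2 t] t1 t2 t D1 pos
          virtual_span_single_crossing[OF virtual_span_add[OF virtual_span_add
            [OF virtual_span_scale[OF virtual_span_\<phi>] virtual_span_scale[OF D_span]]
            virtual_span_scale[OF r_span]]]
        by simp
      then show ?thesis by (simp add: r_def)
    qed
    \<comment> \<open>Hence tied bundles separate wherever \<open>D\<close> is nonzero.\<close>
    have c_inj: "k = k'" if "k \<in> K" "k' \<in> K" "c k = c k'" for k k'
    proof (rule ccontr)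
      assume "k \<noteq> k'"
      then obtain t where "t \<in> types" "\<phi> k t \<noteq> \<phi> k' t" using virtual_distinct by blast
      with proportional[OF that(1)] proportional[OF that(2)] that(3) show False
        by (metis diff_left_imp_eq)
    qed
    let ?S = "closed_segment t1 t2"
    have S: "?S \<subseteq> types"
      using t1 t2 unfolding types_def by (intro closed_segment_subset) auto
    have lead: "\<phi> e s < \<phi> b s" if e: "e \<notin> K" and s: "s \<in> ?S" "D s = 0" for e s
    proof (cases "s = t1")
      case True
      obtain x where "\<phi> e t1 < \<phi> x t1" using e by (auto simp: K_def not_le)
      with b True show ?thesis by (auto simp: K_def intro: less_le_trans)
    next
      case False
      define g where "g = (\<lambda>t. \<phi> b t - \<phi> e t)"
      \<comment> \<open>Adding a multiple of \<open>D\<close> changes nothing at \<open>t1\<close>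
        and \<open>s\<close>, where \<open>D\<close> vanishes; this multiple makes
        \<open>h t2 \<ge> 1\<close>, so that \<open>s\<close> lies between two points where
        \<open>h\<close> is positive.\<close>
      define x where "x = (1 + \<bar>g t2\<bar>) / D t2"
      define h where "h = (\<lambda>t. g t + x * D t)"
      have sc: "single_crossing_on types h"
        unfolding h_def g_def
        by (intro virtual_span_single_crossing virtual_span_add virtual_span_diff virtual_span_scale virtual_span_\<phi> D_span)
      obtain y where "\<phi> e t1 < \<phi> y t1" using e by (auto simp: K_def not_le)
      then have "g t1 > 0" using b by (auto simp: K_def g_def intro: less_le_trans)
      then have "h t1 > 0" by (simp add: h_def D1)
      moreover have "h t2 > 0" using t2 by (simp add: h_def x_def)
      moreover have "t1 \<le> s \<and> s \<le> t2 \<or> t2 \<le> s \<and> s \<le> t1"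
        using s(1) by (auto simp: closed_segment_eq_real_ivl split: if_splits)
      ultimately have "h s > 0"
        using single_crossing_no_return[OF sc] t1 t2 S s(1) by blast
      then show ?thesis by (simp add: h_def g_def s(2))
    qed
    \<comment> \<open>\<open>Z\<close> and \<open>R\<close> are closed and disjoint, and
      \<open>t1\<close> is in \<open>Z\<close> but \<open>t2\<close> is not. By connectedness they
      cannot cover the segment; an uncovered point has \<open>D\<close> nonzero and \<open>b\<close>
      ahead of every bundle outside \<open>K\<close>.\<close>
    define Z where "Z = {s \<in> ?S. D s = 0}"
    define R where "R = (\<Union>e\<in>-K. {s \<in> ?S. \<phi> b s \<le> \<phi> e s})"
    have \<phi>_S: "continuous_on ?S (\<phi> e)" for e
      using \<phi>_continuous S by (rule continuous_on_subset)
    have "closed Z"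
      unfolding Z_def D_def by (intro continuous_closed_preimage_constant continuous_intros \<phi>_S) auto
    moreover have "closed R"
      unfolding R_def by (intro closed_UN ballI continuous_on_closed_Collect_le \<phi>_S) auto
    moreover have "Z \<inter> R = {}"
      using lead by (fastforce simp: Z_def R_def)
    moreover have mem: "t1 \<in> Z \<inter> ?S" "t2 \<in> ?S" "t2 \<notin> Z"
      using D1 t2 by (auto simp: Z_def)
    ultimately have "\<not> ?S \<subseteq> Z \<union> R"
      using connected_segment(1)[of t1 t2] unfolding connected_closed by blast
    then obtain s where "s \<in> ?S" "s \<notin> Z" "s \<notin> R"
      by blast
    then have s: "s \<in> ?S" "D s \<noteq> 0" "\<And>e. e \<notin> K \<Longrightarrow> \<phi> e s < \<phi> b s"
      by (auto simp: Z_def R_def not_le)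
    have "Max ((\<lambda>k. \<phi> k s) ` K) \<in> (\<lambda>k. \<phi> k s) ` K"
      using b by (intro Max_in) auto
    then obtain k where k: "k \<in> K" "\<phi> k s = Max ((\<lambda>k. \<phi> k s) ` K)"
      by (metis (no_types, lifting) imageE)
    have k_max: "\<phi> k' s \<le> \<phi> k s" if "k' \<in> K" for k'
      using that unfolding k(2) by (intro Max_ge) auto
    have "\<phi> e s < \<phi> k s" if "e \<noteq> k" for e
    proof (cases "e \<in> K")
      case True
      have "\<phi> e s \<noteq> \<phi> k s"
      proof
        assume "\<phi> e s = \<phi> k s"
        then have "c e * D s = c k * D s"
          using proportional[OF True, of s] proportional[OF k(1), of s] s(1) S by auto
        then show False using c_inj[OF True k(1)] s(2) that by auto
      qed
      with k_max[OF True] show ?thesis by simp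
    next
      case False
      with s(3) k_max[OF b] show ?thesis by (auto intro: less_le_trans)
    qed
    then have "k \<in> core_menu"
      using s(1) S by (auto simp: core_menu_def)
    with k(1) show ?thesis by (auto simp: K_def)
  qed
qed

text \<open>
  If \<open>v b' - v b\<close> were decreasing, it would be bounded below by its positive value at \<open>hi\<close> and its
  virtual counterpart would be positive everywhere.
\<close>

lemma virtual_up_crossing:
  assumes xy: "x \<in> types" "y \<in> types" "x \<le> y" and x: "\<phi> b' x < \<phi> b x" and y: "\<phi> b y < \<phi> b' y"
  shows "v b hi < v b' hi" and "mono_on types (\<lambda>t. sgn (\<phi> b' t - \<phi> b t))"
    and "mono_on types (\<lambda>t. v b' t - v b t)"
proof -
  show sgn: "mono_on types (\<lambda>t. sgn (\<phi> b' t - \<phi> b t))"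
    using single_crossing_up[OF \<phi>_diff_crossing xy, of b' b] x y by simp
  \<comment> \<open>The sign is already 1 at \<open>y\<close>, hence also at \<open>hi\<close>,
    where virtual values equal values.\<close>
  have "sgn (\<phi> b' y - \<phi> b y) \<le> sgn (\<phi> b' hi - \<phi> b hi)"
    using mono_onD[OF sgn xy(2) hi_in_types] xy(2) by (simp add: types_def)
  with y show hi: "v b hi < v b' hi"
    by (simp add: \<phi>_hi sgn_if split: if_splits)
  show "mono_on types (\<lambda>t. v b' t - v b t)"
  proof (rule ccontr)
    assume "\<not> ?thesis"
    then have anti: "antimono_on types (\<lambda>t. v b' t - v b t)"
      using value_monotonic[of b' b] by (simp add: monotonic_on_def)
    have "x \<le> hi" using xy(1) by (simp add: types_def)
    then have d: "v b' x - v b x \<ge> v b' hi - v b hi"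
      using anti xy(1) hi_in_types unfolding monotone_on_def by blast
    have "mono_on types (\<lambda>t. v b t - v b' t)"
      using anti unfolding monotone_on_def by fastforce
    then have "v_t b x - v_t b' x \<ge> 0"
      using xy(1) lo_less_hi v_has_derivative[OF xy(1)] unfolding types_def
      by (intro mono_on_deriv_nonneg_within[of lo hi "\<lambda>t. v b t - v b' t" _ x])
        (auto intro!: derivative_intros)
    then have "(1 - F x) / f x * (v_t b x - v_t b' x) \<ge> 0"
      using F_le_1[OF xy(1)] density_pos[OF xy(1)] by simp
    with d hi x show False
      by (simp add: \<phi>_def right_diff_distrib)
  qed
qed

text \<open>Each bundle wins strictly at a type of its own; the cases are the order of these two
  types.\<close>

lemma core_menu_cases:
  assumes "b \<in> core_menu" "b' \<in> core_menu" "b \<noteq> b'"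
  obtains x y where "x \<in> types" "y \<in> types" "x \<le> y" "\<phi> b' x < \<phi> b x" "\<phi> b y < \<phi> b' y"
  | x y where "x \<in> types" "y \<in> types" "x \<le> y" "\<phi> b x < \<phi> b' x" "\<phi> b' y < \<phi> b y"
proof -
  obtain t where t: "t \<in> types" "\<phi> b' t < \<phi> b t"
    using assms by (auto simp: core_menu_def)
  obtain t' where t': "t' \<in> types" "\<phi> b t' < \<phi> b' t'"
    using assms by (auto simp: core_menu_def)
  show ?thesis
    using that(1)[of t t'] that(2)[of t' t] t t' by linarith
qed

text \<open>This makes the value at \<open>hi\<close> a real label for the bundles of
  \<open>core_menu\<close>, by which they are ordered and identified below.\<close>

lemma core_menu_value_hi_inj:
  assumes "b \<in> core_menu" "b' \<in> core_menu" "v b hi = v b' hi"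
  shows "b = b'"
proof (rule ccontr)
  assume "b \<noteq> b'"
  with assms(1,2) show False
    by (cases rule: core_menu_cases) (use virtual_up_crossing(1) assms(3) in fastforce)+
qed

text \<open>The opposite order of crossing would rank the values at \<open>hi\<close> the other
  way.\<close>

lemma core_menu_order:
  assumes b: "b \<in> core_menu" "b' \<in> core_menu" and less: "v b hi < v b' hi"
  shows "mono_on types (\<lambda>t. sgn (\<phi> b' t - \<phi> b t))"
    and "mono_on types (\<lambda>t. v b' t - v b t)"
proof -
  have "b \<noteq> b'" using less by auto
  with b obtain x y where "x \<in> types" "y \<in> types" "x \<le> y" "\<phi> b' x < \<phi> b x" "\<phi> b y < \<phi> b' y"
    by (cases rule: core_menu_cases) (use virtual_up_crossing(1) less in fastforce)+
  then show "mono_on types (\<lambda>t. sgn (\<phi> b' t - \<phi> b t))" "mono_on types (\<lambda>t. v b' t - v b t)"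
    by (fact virtual_up_crossing(2), fact virtual_up_crossing(3))
qed

subsection \<open>The optimal mechanism\<close>

text \<open>Such a choice exists by \<open>core_menu_attains_max\<close>. Breaking ties towards the
  larger value at \<open>hi\<close> keeps the selection monotone at ties.\<close>

definition best :: "real \<Rightarrow> 'g set" where
  "best t = (SOME b. b \<in> core_menu \<and> (\<forall>b'. \<phi> b' t \<le> \<phi> b t) \<and>
     (\<forall>b'\<in>core_menu. \<phi> b' t = \<phi> b t \<longrightarrow> v b' hi \<le> v b hi))"

lemma
  assumes t: "t \<in> types"
  shows best_in_core: "best t \<in> core_menu"
    and best_max: "\<phi> b t \<le> \<phi> (best t) t"
    and best_ties: "b \<in> core_menu \<Longrightarrow> \<phi> b t = \<phi> (best t) t \<Longrightarrow> v b hi \<le> v (best t) hi"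
proof -
  define A where "A = {b \<in> core_menu. \<forall>b'. \<phi> b' t \<le> \<phi> b t}"
  have "finite A" "A \<noteq> {}"
    using core_menu_attains_max[OF t] by (auto simp: A_def)
  then obtain b where b: "b \<in> A" "\<And>b'. b' \<in> A \<Longrightarrow> v b' hi \<le> v b hi"
    using ex_is_arg_min_if_finite[of A "\<lambda>b. - v b hi"] by (auto simp: is_arg_min_def not_less)
  have tie: "b' \<in> A" if "b' \<in> core_menu" "\<phi> b' t = \<phi> b t" for b'
    using b(1) that by (simp add: A_def)
  have "\<exists>b. b \<in> core_menu \<and> (\<forall>b'. \<phi> b' t \<le> \<phi> b t) \<and>
      (\<forall>b'\<in>core_menu. \<phi> b' t = \<phi> b t \<longrightarrow> v b' hi \<le> v b hi)"
    using b tie by (intro exI[of _ b]) (auto simp: A_def)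
  from someI_ex[OF this, folded best_def]
  show "best t \<in> core_menu" "\<phi> b t \<le> \<phi> (best t) t"
    "b \<in> core_menu \<Longrightarrow> \<phi> b t = \<phi> (best t) t \<Longrightarrow> v b hi \<le> v (best t) hi" for b
    by blast+
qed

text \<open>If \<open>best s\<close> had the larger value at \<open>hi\<close>, its weak lead over
  \<open>best t\<close> at \<open>s\<close> would persist at \<open>t\<close>. There it would tie
  and win the tie-break.\<close>

lemma best_mono: "mono_on types (\<lambda>t. v (best t) hi)"
proof (rule mono_onI, rule ccontr)
  fix s t assume st: "s \<in> types" "t \<in> types" "s \<le> t" and "\<not> v (best s) hi \<le> v (best t) hi"
  then have less: "v (best t) hi < v (best s) hi" by simp
  have "sgn (\<phi> (best s) s - \<phi> (best t) s) \<le> sgn (\<phi> (best s) t - \<phi> (best t) t)"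
    using core_menu_order(1)[OF best_in_core best_in_core less] st by (auto dest: mono_onD)
  moreover have "\<phi> (best s) s - \<phi> (best t) s \<ge> 0"
    using best_max[OF st(1)] by simp
  ultimately have "\<phi> (best s) t \<ge> \<phi> (best t) t"
    by (auto simp: sgn_if split: if_splits)
  then have "\<phi> (best s) t = \<phi> (best t) t"
    using best_max[OF st(2)] by (intro antisym)
  then show False
    using best_ties[OF st(2) best_in_core[OF st(1)]] less by simp
qed

lemma best_lo: "best lo = {}"
  using best_max[OF lo_in_types, of "{}"] virtual_lo_neg[of "best lo"] \<phi>_empty[OF lo_in_types]
  by fastforce

text \<open>The label \<open>v (best t) hi\<close> is monotone in \<open>t\<close>, hence Borel, and
  it identifies \<open>best t\<close>.\<close>

lemma best_measurable:
  "(\<lambda>t. of_bool (best t = b) :: real) \<in> borel_measurable (restrict_space borel types)"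
proof -
  let ?M = "restrict_space borel types"
  have [measurable]: "(\<lambda>t. v (best t) hi) \<in> borel_measurable ?M"
    by (rule borel_measurable_mono_on_fnc[OF best_mono])
  have iff: "best t = b \<longleftrightarrow> b \<in> core_menu \<and> v (best t) hi = v b hi" if "t \<in> types" for t
    using best_in_core[OF that] core_menu_value_hi_inj[of "best t" b] by blast
  have "of_bool (best t = b) = (of_bool (b \<in> core_menu \<and> v (best t) hi = v b hi) :: real)"
    if "t \<in> space ?M" for t
    by (subst iff) (use that in \<open>simp_all add: space_restrict_space\<close>)
  note measurable_cong[OF this]
  moreover have "(\<lambda>t. of_bool (b \<in> core_menu \<and> v (best t) hi = v b hi) :: real) \<in> borel_measurable ?M"
    by measurable
  ultimately show ?thesis
    by (rule iffD2)
qed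

text \<open>The monotonicity that implementability rests on: higher types receive bundles whose
  values are steeper at every type.\<close>

lemma best_value_deriv_mono:
  assumes st: "s \<in> types" "t \<in> types" "s \<le> t" and r: "r \<in> types"
  shows "v_t (best s) r \<le> v_t (best t) r"
proof (cases "best s = best t")
  case False
  have "v (best s) hi < v (best t) hi"
    using False mono_onD[OF best_mono st] core_menu_value_hi_inj best_in_core st
    by (metis order_le_less)
  then have "mono_on types (\<lambda>r. v (best t) r - v (best s) r)"
    using best_in_core st by (intro core_menu_order(2))
  then have "v_t (best t) r - v_t (best s) r \<ge> 0"
    using r lo_less_hi v_has_derivative[OF r] unfolding types_def
    by (intro mono_on_deriv_nonneg_within[of lo hi "\<lambda>r. v (best t) r - v (best s) r" _ r])
      (auto intro!: derivative_intros)
  then show ?thesis by simp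
qed simp

text \<open>The utility dictated by the envelope formula, starting from zero at \<open>lo\<close>;
  \<open>price\<close> is set so that truthful types receive exactly this.\<close>

definition rent :: "real \<Rightarrow> real" where
  "rent t = integral {lo..t} (\<lambda>s. v_t (best s) s)"

definition price :: "real \<Rightarrow> real" where
  "price t = v (best t) t - rent t"

lemma rent_integrable: "(\<lambda>s. v_t (best s) s) integrable_on types"
proof -
  have "bounded (v_t b ` types)" for b
    using compact_continuous_image[OF value_deriv_continuous] by (simp add: compact_imp_bounded types_def)
  then have "\<forall>b. \<exists>C. \<forall>t\<in>types. \<bar>v_t b t\<bar> \<le> C"
    by (auto simp: bounded_iff)
  then obtain C where C: "\<And>b t. t \<in> types \<Longrightarrow> \<bar>v_t b t\<bar> \<le> C b"
    by metis
  have "(\<lambda>s. v_t (best s) s) = (\<lambda>s. \<Sum>b\<in>UNIV. of_bool (best s = b) * v_t b s)"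
    by (simp add: of_bool_def if_distrib[of "\<lambda>x. x * _"] cong: if_cong)
  moreover have "(\<lambda>s. \<Sum>b\<in>UNIV. of_bool (best s = b) * v_t b s) integrable_on {lo..hi}"
    using best_measurable value_deriv_continuous C unfolding types_def
    by (intro bounded_borel_sum_integrable[where B=1 and C=C]) auto
  ultimately show ?thesis by (simp add: types_def)
qed

text \<open>Between \<open>s\<close> and \<open>t\<close> the slope of the rent lies between those
  of the values of \<open>best s\<close> and \<open>best t\<close>. The first bound stops
  \<open>t\<close> from imitating \<open>s\<close>, the second stops \<open>s\<close> from imitating
  \<open>t\<close>.\<close>

lemma rent_diff:
  assumes "s \<in> types" "t \<in> types" "s \<le> t"
  shows "v (best s) t - v (best s) s \<le> rent t - rent s"
    and "rent t - rent s \<le> v (best t) t - v (best t) s"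
proof -
  have sub: "{s..t} \<subseteq> types" using assms by (auto simp: types_def)
  have int: "(\<lambda>s. v_t (best s) s) integrable_on {c..d}" if "c \<in> types" "d \<in> types" for c d
    by (rule integrable_subinterval_real[OF rent_integrable[unfolded types_def]])
      (use that in \<open>auto simp: types_def\<close>)
  have diff: "rent t - rent s = integral {s..t} (\<lambda>s. v_t (best s) s)"
    using Henstock_Kurzweil_Integration.integral_combine[of lo s t] int[of lo t] assms
    by (force simp: rent_def types_def)
  have ftc: "(v_t b has_integral (v b t - v b s)) {s..t}" for b
    using assms(3) sub DERIV_subset[OF v_has_derivative sub]
    by (intro fundamental_theorem_of_calculus)
      (auto simp: has_real_derivative_iff_has_vector_derivative[symmetric])
  show "v (best s) t - v (best s) s \<le> rent t - rent s"
    unfolding diff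
    by (rule has_integral_le[OF ftc integrable_integral[OF int]])
      (use assms sub in \<open>auto intro!: best_value_deriv_mono\<close>)
  show "rent t - rent s \<le> v (best t) t - v (best t) s"
    unfolding diff
    by (rule has_integral_le[OF integrable_integral[OF int] ftc])
      (use assms sub in \<open>auto intro!: best_value_deriv_mono\<close>)
qed

lemma rent_continuous: "continuous_on types rent"
  using rent_integrable unfolding rent_def[abs_def] types_def
  by (rule indefinite_integral_continuous_1)

lemma rent_lo: "rent lo = 0"
  by (simp add: rent_def)

lemma best_feasible: "feasible (\<lambda>t. return_pmf (best t)) price"
proof -
  have "(\<lambda>t. \<Sum>b\<in>UNIV. of_bool (best t = b) * v b t) \<in> borel_measurable (restrict_space borel types)"
    by (intro borel_measurable_sum borel_measurable_times best_measurable
        borel_measurable_continuous_on_restrict v_continuous)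
  then have "(\<lambda>t. v (best t) t) \<in> borel_measurable (restrict_space borel types)"
    by (simp add: of_bool_def if_distrib[of "\<lambda>x. x * _"] cong: if_cong)
  then have "price \<in> borel_measurable (restrict_space borel types)"
    unfolding price_def[abs_def]
    by (rule borel_measurable_diff[OF _ borel_measurable_continuous_on_restrict[OF rent_continuous]])
  moreover have "(\<lambda>t. pmf (return_pmf (best t)) b) \<in> borel_measurable (restrict_space borel types)" for b
    using best_measurable[of b] by (simp add: indicator_def of_bool_def eq_commute)
  moreover have "rent t - rent s \<ge> v (best s) t - v (best s) s" if "s \<in> types" "t \<in> types" for s t
    using rent_diff[of s t] rent_diff[of t s] that by (cases "s \<le> t") auto
  then have "IC (\<lambda>t. return_pmf (best t)) price"
    by (fastforce simp: IC_def price_def)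
  \<comment> \<open>Since \<open>best lo = {}\<close> is worth nothing to anyone, the lower bound on
    the rent starting from \<open>lo\<close> is zero.\<close>
  moreover have "rent t \<ge> 0" if "t \<in> types" for t
    using rent_diff(1)[of lo t] that
    by (simp add: best_lo rent_lo value_empty) (simp add: types_def)
  then have "IR (\<lambda>t. return_pmf (best t)) price"
    by (simp add: IR_def price_def)
  ultimately show ?thesis
    by (simp add: feasible_def mechanism_def)
qed

lemma best_revenue: "revenue price = integral types (\<lambda>t. f t * \<phi> (best t) t)"
  using feasible_revenue(2)[OF best_feasible] by (simp add: price_def rent_lo)

lemma best_virtual_integrable: "(\<lambda>t. f t * \<phi> (best t) t) integrable_on types"
  using feasible_revenue(1)[OF best_feasible] by simp

lemma \<phi>_sto_le_best:
  assumes "t \<in> types"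
  shows "\<phi>_sto a t \<le> \<phi> (best t) t"
proof -
  have "\<phi>_sto a t \<le> (\<Sum>b\<in>UNIV. pmf a b * \<phi> (best t) t)"
    unfolding \<phi>_sto_eq by (intro sum_mono mult_left_mono best_max assms) auto
  also have "\<dots> = \<phi> (best t) t"
    by (simp add: sum_distrib_right[symmetric] sum_pmf_eq_1)
  finally show ?thesis .
qed

text \<open>\<open>best\<close> maximizes the virtual value type by type and leaves type
  \<open>lo\<close> no rent, while IR makes that rent nonnegative in every feasible
  mechanism.\<close>

lemma best_optimal: "optimal_mechanism (\<lambda>t. return_pmf (best t)) price"
proof -
  have "revenue p \<le> revenue price" if feas: "feasible a p" for a p
  proof -
    have "integral types (\<lambda>t. f t * \<phi>_sto (a t) t) \<le> integral types (\<lambda>t. f t * \<phi> (best t) t)"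
      using feasible_revenue(1)[OF feas] best_virtual_integrable
      by (rule integral_le) (auto intro!: mult_left_mono \<phi>_sto_le_best simp: density_pos less_imp_le)
    moreover have "value_sto (a lo) lo - p lo \<ge> 0"
      using feas by (simp add: feasible_def IR_def)
    ultimately show ?thesis
      unfolding feasible_revenue(2)[OF feas] best_revenue by linarith
  qed
  then show ?thesis
    using best_feasible by (auto simp: optimal_mechanism_def)
qed

section \<open>Minimality and uniqueness of the optimal menu\<close>

lemma core_menu_optimal: "optimal_menu core_menu"
  unfolding optimal_menu_def using best_optimal best_in_core by blast

text \<open>
  A menu without \<open>b\<close> loses at least the integral of the continuous function \<open>gap\<close>, which is
  positive where \<open>b\<close> is the strict maximizer.
\<close>

lemma core_menu_subset_optimal:
  assumes "optimal_menu B"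
  shows "core_menu \<subseteq> B"
proof
  fix b assume "b \<in> core_menu"
  then obtain t0 where t0: "t0 \<in> types" "\<And>b'. b' \<noteq> b \<Longrightarrow> \<phi> b' t0 < \<phi> b t0"
    unfolding core_menu_def by blast
  obtain a p where opt: "optimal_mechanism a p" and a: "\<And>t. t \<in> types \<Longrightarrow> a t \<in> return_pmf ` B"
    using assms unfolding optimal_menu_def by blast
  then have feas: "feasible a p" by (simp add: optimal_mechanism_def)
  show "b \<in> B"
  proof (rule ccontr)
    assume "b \<notin> B"
    \<comment> \<open>Truncation to the unit interval makes the product at most each single factor,
      hence at most the lead of \<open>b\<close> over whichever other bundle is sold, when that lead
      is nonnegative, and zero otherwise.\<close>
    define factor where "factor t b' = min 1 (max 0 (\<phi> b t - \<phi> b' t))" for t b'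
    define gap where "gap t = f t * (\<Prod>b'\<in>-{b}. factor t b')" for t
    have gap_cont: "continuous_on types gap"
      unfolding gap_def factor_def
      by (intro continuous_intros continuous_on_prod density_continuous \<phi>_continuous)
    have gap_nonneg: "gap t \<ge> 0" if "t \<in> types" for t
      unfolding gap_def factor_def using density_pos[OF that]
      by (intro mult_nonneg_nonneg prod_nonneg) auto
    have "(\<Prod>b'\<in>-{b}. factor t0 b') > 0"
      by (rule prod_pos) (use t0 in \<open>auto simp: factor_def\<close>)
    then have "gap t0 > 0"
      using density_pos[OF t0(1)] unfolding gap_def by (rule mult_pos_pos[rotated])
    then have "integral types gap \<noteq> 0"
      using integral_eq_0_iff[of lo hi gap] gap_cont gap_nonneg lo_less_hi t0(1) by (auto simp: types_def)
    moreover have "integral types gap \<ge> 0"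
      using gap_nonneg gap_cont by (intro integral_nonneg) (auto simp: types_def integrable_continuous_real)
    ultimately have gap_pos: "integral types gap > 0" by simp
    have gap_int: "gap integrable_on types"
      using gap_cont by (simp add: types_def integrable_continuous_real)
    have "integral types (\<lambda>t. f t * \<phi>_sto (a t) t + gap t) \<le> integral types (\<lambda>t. f t * \<phi> (best t) t)"
    proof (rule integral_le)
      fix t assume t: "t \<in> types"
      obtain e where e: "a t = return_pmf e" "e \<noteq> b"
        using a[OF t] \<open>b \<notin> B\<close> by auto
      have "(\<Prod>b'\<in>-{b}. factor t b') = factor t e * (\<Prod>b'\<in>-{b}-{e}. factor t b')"
        using e by (intro prod.remove) auto
      also have "\<dots> \<le> factor t e * 1"
        by (intro mult_left_mono prod_le_1) (auto simp: factor_def)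
      also have "\<dots> \<le> \<phi> (best t) t - \<phi> e t"
        using best_max[OF t, of b] best_max[OF t, of e] by (auto simp: factor_def)
      finally have "f t * (\<Prod>b'\<in>-{b}. factor t b') \<le> f t * (\<phi> (best t) t - \<phi> e t)"
        using density_pos[OF t] by (intro mult_left_mono) auto
      then show "f t * \<phi>_sto (a t) t + gap t \<le> f t * \<phi> (best t) t"
        by (simp add: gap_def e right_diff_distrib)
    qed (use feasible_revenue(1)[OF feas] best_virtual_integrable gap_int in \<open>auto intro: integrable_add\<close>)
    then have "integral types (\<lambda>t. f t * \<phi>_sto (a t) t) + integral types gap \<le> revenue price"
      using feasible_revenue(1)[OF feas] gap_int
      by (simp add: Henstock_Kurzweil_Integration.integral_add best_revenue)
    moreover have "value_sto (a lo) lo - p lo \<ge> 0"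
      using feas by (simp add: feasible_def IR_def)
    ultimately have "revenue p < revenue price"
      using gap_pos unfolding feasible_revenue(2)[OF feas] by linarith
    with opt best_feasible show False
      by (auto simp: optimal_mechanism_def not_le[symmetric])
  qed
qed

text \<open>\<open>core_menu\<close> is optimal and contained in every optimal menu, so it is the
  least one.\<close>

lemma minimal_optimal_menu_iff: "minimal_optimal_menu B \<longleftrightarrow> B = core_menu"
  unfolding minimal_optimal_menu_def
  using core_menu_optimal core_menu_subset_optimal by (metis psubsetI psubset_eq subset_antisym)

subsection \<open>The root\<close>

text \<open>Names the type inside the definition of \<open>Q\<close>: a larger \<open>Q\<close>
  means an earlier zero.\<close>

definition virtual_zero :: "'g set \<Rightarrow> real" where
  "virtual_zero b = (THE t. t \<in> types \<and> \<phi> b t = 0)"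

text \<open>The virtual value is negative at \<open>lo\<close> and positive at \<open>hi\<close>, so
  single crossing makes its sign increase; uniqueness of the zero makes the signs on both sides
  strict.\<close>

lemma
  assumes b: "b \<noteq> {}"
  shows virtual_zero_in_types: "virtual_zero b \<in> types"
    and \<phi>_virtual_zero: "\<phi> b (virtual_zero b) = 0"
    and \<phi>_neg: "t \<in> types \<Longrightarrow> t < virtual_zero b \<Longrightarrow> \<phi> b t < 0"
    and \<phi>_pos: "t \<in> types \<Longrightarrow> virtual_zero b < t \<Longrightarrow> \<phi> b t > 0"
proof -
  have "virtual_zero b \<in> types \<and> \<phi> b (virtual_zero b) = 0"
    unfolding virtual_zero_def by (rule theI'[OF virtual_zero_unique[OF b]])
  then show z: "virtual_zero b \<in> types" "\<phi> b (virtual_zero b) = 0"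
    by (fact conjunct1, fact conjunct2)
  have unique: "t = virtual_zero b" if "t \<in> types" "\<phi> b t = 0" for t
    using virtual_zero_unique[OF b] z that by blast
  have "mono_on types (\<lambda>t. sgn (\<phi> b t))"
    using virtual_span_single_crossing[OF virtual_span_\<phi>] lo_in_types hi_in_types
    by (rule single_crossing_up) (use lo_less_hi virtual_lo_neg[OF b] value_hi_pos[OF b] \<phi>_hi in auto)
  then have "sgn (\<phi> b s) \<le> sgn (\<phi> b t)" if "s \<in> types" "t \<in> types" "s \<le> t" for s t
    using that by (auto dest: mono_onD)
  from this[OF _ z(1)] this[OF z(1)]
  show "t \<in> types \<Longrightarrow> t < virtual_zero b \<Longrightarrow> \<phi> b t < 0"
    "t \<in> types \<Longrightarrow> virtual_zero b < t \<Longrightarrow> \<phi> b t > 0" for t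
    using unique[of t] z(2) by (force simp: sgn_if split: if_splits)+
qed

lemma Q_eq: "b \<noteq> {} \<Longrightarrow> Q b = 1 - F (virtual_zero b)"
  by (simp add: Q_def virtual_zero_def)

context
  fixes r :: "'g set"
  assumes Q_root: "\<And>b. b \<noteq> r \<Longrightarrow> Q b < Q r"
begin

text \<open>\<open>Q {} = 0\<close> cannot strictly exceed \<open>Q UNIV\<close>, which is
  nonnegative.\<close>

lemma root_nonempty: "r \<noteq> {}"
proof
  assume "r = {}"
  then have "Q UNIV < 0"
    using Q_root[of UNIV] by (simp add: Q_def[of "{}"])
  then show False
    using F_le_1[OF virtual_zero_in_types[of UNIV]] by (simp add: Q_eq)
qed

lemma root_first: "b \<noteq> {} \<Longrightarrow> b \<noteq> r \<Longrightarrow> virtual_zero r < virtual_zero b"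
  using Q_root[of b] monoD[OF F_mono, of "virtual_zero b" "virtual_zero r"] root_nonempty
  by (force simp: Q_eq not_le[symmetric])

text \<open>At the zero of \<open>r\<close> all other nonempty bundles still have negative virtual
  value. By continuity they stay behind \<open>r\<close> just to the right of it, where
  \<open>r\<close> also beats the empty bundle.\<close>

lemma root_in_core: "r \<in> core_menu"
proof -
  let ?z = "virtual_zero r"
  note z = virtual_zero_in_types[OF root_nonempty] \<phi>_virtual_zero[OF root_nonempty]
  have "?z \<noteq> hi"
    using z(2) \<phi>_hi value_hi_pos[OF root_nonempty] by auto
  then have z_hi: "?z < hi" using z(1) by (simp add: types_def)
  let ?G = "at ?z within {?z<..hi}"
  have "\<forall>\<^sub>F t in ?G. \<phi> b t < \<phi> r t" if b: "b \<noteq> r" "b \<noteq> {}" for b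
  proof -
    have "((\<lambda>t. \<phi> r t - \<phi> b t) \<longlongrightarrow> \<phi> r ?z - \<phi> b ?z) (at ?z within types)"
      using \<phi>_continuous z(1) by (intro tendsto_diff) (auto simp: continuous_on_def)
    then have "((\<lambda>t. \<phi> r t - \<phi> b t) \<longlongrightarrow> \<phi> r ?z - \<phi> b ?z) ?G"
      by (rule tendsto_within_subset) (use z(1) in \<open>auto simp: types_def\<close>)
    moreover have "0 < \<phi> r ?z - \<phi> b ?z"
      using \<phi>_neg[OF b(2) z(1) root_first[OF b(2,1)]] z(2) by simp
    ultimately have "\<forall>\<^sub>F t in ?G. 0 < \<phi> r t - \<phi> b t"
      by (rule order_tendstoD(1))
    then show ?thesis by simp
  qed
  then have ev1: "\<forall>\<^sub>F t in ?G. \<forall>b\<in>-{r,{}}. \<phi> b t < \<phi> r t"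
    by (intro eventually_ball_finite) auto
  have ev2: "\<forall>\<^sub>F t in ?G. t \<in> {?z<..hi}"
    by (simp add: eventually_at_filter)
  have "?G \<noteq> bot"
    using z_hi by (simp add: at_within_eq_bot_iff)
  from eventually_happens'[OF this eventually_conj[OF ev1 ev2]]
  obtain t where t: "t \<in> {?z<..hi}" "\<And>b. b \<in> -{r,{}} \<Longrightarrow> \<phi> b t < \<phi> r t"
    by blast
  have tt: "t \<in> types" using t(1) z(1) by (auto simp: types_def)
  have "\<phi> {} t < \<phi> r t"
    using \<phi>_pos[OF root_nonempty tt] t(1) \<phi>_empty[OF tt] by simp
  then show ?thesis
    using t(2) tt unfolding core_menu_def by blast
qed

text \<open>At the zero of \<open>r\<close> the root leads \<open>b\<close>; where \<open>b\<close>
  is the strict maximizer its virtual value is positive, so that type comes later. Hence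
  \<open>b\<close> crosses \<open>r\<close> from below.\<close>

lemma root_beaten_at_top:
  assumes b: "b \<in> core_menu" "b \<noteq> {}" "b \<noteq> r"
  shows "v r hi < v b hi"
proof -
  let ?z = "virtual_zero r"
  note z = virtual_zero_in_types[OF root_nonempty] \<phi>_virtual_zero[OF root_nonempty]
  obtain t where t: "t \<in> types" "\<And>b'. b' \<noteq> b \<Longrightarrow> \<phi> b' t < \<phi> b t"
    using b(1) by (auto simp: core_menu_def)
  have "\<phi> b t > 0" using t(2)[of "{}"] b(2) \<phi>_empty[OF t(1)] by simp
  have "?z \<le> t"
  proof (rule ccontr)
    assume "\<not> ?z \<le> t"
    then have "\<phi> b t < 0"
      using root_first[OF b(2,3)] by (intro \<phi>_neg[OF b(2) t(1)]) auto
    with \<open>\<phi> b t > 0\<close> show False by simp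
  qed
  moreover have "\<phi> b ?z < \<phi> r ?z"
    using \<phi>_neg[OF b(2) z(1) root_first[OF b(2,3)]] z(2) by simp
  ultimately show ?thesis
    using virtual_up_crossing(1)[OF z(1) t(1)] t(2)[of r] b(3) by blast
qed

end

end

theorem proposition5:
  fixes lo hi :: real
    and f :: "real \<Rightarrow> real"
    and v :: "'g::finite set \<Rightarrow> real \<Rightarrow> real"
    and b_root :: "'g set"
  assumes standing: "bundling_setup lo hi f v"
    and A1_virtual: "\<And>b b'. single_crossing_on {lo..hi}
          (\<lambda>t. bundling.\<phi> lo hi f v b t - bundling.\<phi> lo hi f v b' t)"
    and A1_value: "\<And>b b'. monotonic_on {lo..hi} (\<lambda>t. v b t - v b' t)"
    and A2: "\<And>a a'. single_crossing_on {lo..hi}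
          (\<lambda>t. bundling.\<phi>_sto lo hi f v a t - bundling.\<phi>_sto lo hi f v a' t)"
    and argmax_root: "{b_root} = {b. is_arg_max (bundling.Q lo hi f v) (\<lambda>_. True) b}"
    and value_root: "\<And>b. \<not> b_root \<subseteq> b \<Longrightarrow> v b hi < v b_root hi"
  shows "(\<exists>!B. bundling.minimal_optimal_menu lo hi f v B) \<and>
    (\<forall>B. bundling.minimal_optimal_menu lo hi f v B \<longrightarrow> tree_menu B \<or> nested_menu B)"
proof -
  interpret bundling_setup lo hi f v by (rule standing)
  interpret bundling_crossing lo hi f v
    by unfold_locales (simp_all add: types_def A1_value A2)
  have Q_root: "Q b < Q b_root" if "b \<noteq> b_root" for b
  proof -
    have "is_arg_max Q (\<lambda>_. True) b_root" "\<not> is_arg_max Q (\<lambda>_. True) b"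
      using argmax_root that by blast+
    then obtain y where "Q b < Q y" "\<not> Q b_root < Q y"
      unfolding is_arg_max_def by blast
    then show ?thesis by simp
  qed
  \<comment> \<open>The second condition on the root contradicts being overtaken at
    \<open>hi\<close>.\<close>
  have "b_root \<subseteq> b" if "b \<in> core_menu" "b \<noteq> {}" for b
  proof (rule ccontr)
    assume "\<not> b_root \<subseteq> b"
    then have "v b hi < v b_root hi" "b \<noteq> b_root"
      using value_root by auto
    with root_beaten_at_top[OF Q_root that] show False by simp
  qed
  \<comment> \<open>The root is the common subset; two incomparable bundles make the menu a tree,
    and otherwise it is nested.\<close>
  then have "tree_menu core_menu \<or> nested_menu core_menu"
    using root_in_core[OF Q_root] root_nonempty[OF Q_root]
    unfolding tree_menu_def nested_menu_def by blast
  then show ?thesis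
    by (simp add: minimal_optimal_menu_iff)
qed

end
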